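(* In the setting described in the context: if the model is robust in data (RID), then $\mathcal P_0=(X,\Theta)$ is not geometrically ergodic; and if the model is robust in parameter (RIP), then $\mathcal P_1=(\tilde X,\Theta)$ is not geometrically ergodic.
   Context: Fix an observed value $y\in\mathbb R$. Consider the model $Y=X+Z_1$, $X=\Theta+Z_2$, where $Z_1,Z_2$ are independent real random variables, independent of $\Theta$, whose distributions are symmetric about $0$ and have continuous, bounded, everywhere positive Lebesgue densities $f_1,f_2$; $\Theta$ is given the improper flat (Lebesgue) prior on $\mathbb R$, and the posterior $\mathcal L(X,\Theta\mid Y=y)$ is proper. Write $\tilde X=X-\Theta$. For a parametrisation $\mathcal P=(U,\Theta)$ with $U\in\{X,\tilde X\}$, the Gibbs sampler started at $\Theta_0$ iterates, for $n\ge1$: draw $U_n\sim\mathcal L(U\mid Y=y,\Theta=\Theta_{n-1})$, then $\Theta_n\sim\mathcal L(\Theta\mid Y=y,U=U_n)$. The centred parametrisation is $\mathcal P_0=(X,\Theta)$ and the non-centred one is $\mathcal P_1=(\tilde X,\Theta)$. A parametrisation is called geometrically ergodic if its marginal chain $\{\Theta_n\}$ satisfies $\|\mathcal L(\Theta_n\mid Y=y,\Theta_0)-\mathcal L(\Theta\mid Y=y)\|_{TV}\le M(\Theta_0)r^n$ for all $n$, for some $r<1$ and some function $M$. The model is RIP (robust in parameter) if $\mathcal L(X\mid Y=y,\Theta=\theta)\to\mathcal L(Z_1+y)$ weakly as $|\theta|\to\infty$, and RID (robust in data) if $\mathcal L(\tilde X\mid Y=y,\Theta=\theta)\to\mathcal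 L(\tilde X)=\mathcal L(Z_2)$ weakly as $|\theta|\to\infty$. *)

theory Defs
  imports "HOL-Probability.Probability"
begin

definition normdens :: "(real \<Rightarrow> real) \<Rightarrow> real measure" where
  "normdens g = density lborel (\<lambda>t. ennreal (g t / (\<integral>s. g s \<partial>lborel)))"

text \<open>Unnormalised joint posterior density (flat prior on Theta, Y = y fixed).
  Centred parametrisation (X, Theta): f1(y - x) f2(x - theta).
  Non-centred parametrisation (Xtilde, Theta), X = Xtilde + Theta: f1(y - u - theta) f2(u).\<close>
definition joint0 :: "(real \<Rightarrow> real) \<Rightarrow> (real \<Rightarrow> real) \<Rightarrow> real \<Rightarrow> real \<Rightarrow> real \<Rightarrow> real" where
  "joint0 f1 f2 y x \<theta> = f1 (y - x) * f2 (x - \<theta>)"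

definition joint1 :: "(real \<Rightarrow> real) \<Rightarrow> (real \<Rightarrow> real) \<Rightarrow> real \<Rightarrow> real \<Rightarrow> real \<Rightarrow> real" where
  "joint1 f1 f2 y u \<theta> = f1 (y - u - \<theta>) * f2 u"

definition cond_U :: "(real \<Rightarrow> real \<Rightarrow> real) \<Rightarrow> real \<Rightarrow> real measure" where
  "cond_U j \<theta> = normdens (\<lambda>u. j u \<theta>)"

definition cond_Theta :: "(real \<Rightarrow> real \<Rightarrow> real) \<Rightarrow> real \<Rightarrow> real measure" where
  "cond_Theta j u = normdens (\<lambda>\<theta>. j u \<theta>)"

definition post_Theta :: "(real \<Rightarrow> real \<Rightarrow> real) \<Rightarrow> real measure" where
  "post_Theta j = normdens (\<lambda>\<theta>. \<integral>u. j u \<theta> \<partial>lborel)"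

definition gibbs_kernel :: "(real \<Rightarrow> real \<Rightarrow> real) \<Rightarrow> real \<Rightarrow> real measure" where
  "gibbs_kernel j \<theta> = bind (cond_U j \<theta>) (cond_Theta j)"

fun gibbs_law :: "(real \<Rightarrow> real \<Rightarrow> real) \<Rightarrow> nat \<Rightarrow> real \<Rightarrow> real measure" where
  "gibbs_law j 0 \<theta>0 = return lborel \<theta>0"
| "gibbs_law j (Suc n) \<theta>0 = bind (gibbs_law j n \<theta>0) (gibbs_kernel j)"

definition tv_dist :: "real measure \<Rightarrow> real measure \<Rightarrow> real" where
  "tv_dist M N = (SUP A\<in>sets borel. \<bar>measure M A - measure N A\<bar>)"

definition geom_ergodic :: "(real \<Rightarrow> real \<Rightarrow> real) \<Rightarrow> bool" where
  "geom_ergodic j \<longleftrightarrow> (\<exists>r::real. r < 1 \<and> (\<exists>M::real \<Rightarrow> real.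
     \<forall>\<theta>0 n. tv_dist (gibbs_law j n \<theta>0) (post_Theta j) \<le> M \<theta>0 * r ^ n))"

definition weak_conv_along :: "real filter \<Rightarrow> (real \<Rightarrow> real measure) \<Rightarrow> real measure \<Rightarrow> bool" where
  "weak_conv_along F \<mu> \<nu> \<longleftrightarrow> (\<forall>h::real \<Rightarrow> real. continuous_on UNIV h \<longrightarrow> bounded (range h) \<longrightarrow>
     ((\<lambda>\<theta>. \<integral>x. h x \<partial>(\<mu> \<theta>)) \<longlongrightarrow> (\<integral>x. h x \<partial>\<nu>)) F)"

definition RIP :: "(real \<Rightarrow> real) \<Rightarrow> (real \<Rightarrow> real) \<Rightarrow> real \<Rightarrow> bool" where
  "RIP f1 f2 y \<longleftrightarrow> weak_conv_along at_infinity (cond_U (joint0 f1 f2 y))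
      (density lborel (\<lambda>x. ennreal (f1 (x - y))))"

definition RID :: "(real \<Rightarrow> real) \<Rightarrow> (real \<Rightarrow> real) \<Rightarrow> real \<Rightarrow> bool" where
  "RID f1 f2 y \<longleftrightarrow> weak_conv_along at_infinity (cond_U (joint1 f1 f2 y))
      (density lborel (\<lambda>x. ennreal (f2 x)))"

definition good_density :: "(real \<Rightarrow> real) \<Rightarrow> bool" where
  "good_density f \<longleftrightarrow> continuous_on UNIV f \<and> bounded (range f) \<and> (\<forall>x. f x > 0) \<and>
     (\<forall>x. f (- x) = f x) \<and> integrable lborel f \<and> (\<integral>x. f x \<partial>lborel) = 1"

end

(* The marginal Theta-chain is reversible with respect to its posterior pi, so a pointwise geometric
   rate r forces the L2 spectral-gap inequality <P 1_I, 1_I> - pi(I)^2 <= r (pi(I) - pi(I)^2) for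
   every Borel set I. Under RID the increments of the centred chain stay tight far out, and testing
   RID against k / f2 for translates of a bump k shows that the posterior density m is long-tailed:
   m(theta + s) / m(theta) -> 1. Hence a long interval far out has tiny mass, nearly equal masses in
   blocks of fixed length, and is left only through its two end blocks; there <P 1_I, 1_I> is
   close to pi(I), contradicting the inequality. The non-centred case is the centred one with f1 and
   f2 exchanged. *)
theory Submission
  imports Defs
begin

text \<open>Tight increments alone would not contradict a spectral gap: if the posterior decayed
  exponentially, a far interval would keep a fixed share of its mass in the block at its inner end,
  from which the chain leaves easily. This is why long tails have to be extracted from RID, which
  speaks of \<open>m\<close> only as the normalising constant of a conditional law. A ratio of
  neighbouring blocks that merely tends to 1 is controlled over finitely many blocks only, so the
  interval is finite and its number of blocks is fixed before its position. On the spectral side the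
  constant in the rate depends on the starting point in an uncontrolled way and cannot be integrated
  against the posterior; the inequality is therefore proved first for subsets of I that admit one
  constant, and these exhaust I. Inner products of bounded functions and the Cauchy-Schwarz
  inequality replace a Hilbert space throughout.\<close>

section \<open>Bounded Borel functions\<close>

text \<open>The common domain of all operators below: it is stable under products and Markov
  kernels, and its members are integrable for every Borel probability measure, so integrability
  never has to be discussed case by case.\<close>

definition bounded_borel :: "(real \<Rightarrow> real) \<Rightarrow> bool" where
  "bounded_borel h \<longleftrightarrow> h \<in> borel_measurable borel \<and> (\<exists>C. \<forall>x. \<bar>h x\<bar> \<le> C)"

lemma bounded_borel_measurable [measurable_dest]: "bounded_borel h \<Longrightarrow> h \<in> borel_measurable borel"
  by (simp add: bounded_borel_def)

lemma bounded_borelI: "h \<in> borel_measurable borel \<Longrightarrow> (\<And>x. \<bar>h x\<bar> \<le> C) \<Longrightarrow> bounded_borel h"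
  by (auto simp: bounded_borel_def)

lemma bounded_borelE:
  assumes "bounded_borel h"
  obtains C where "C \<ge> 0" "\<And>x. \<bar>h x\<bar> \<le> C"
proof -
  obtain C where "\<And>x. \<bar>h x\<bar> \<le> C" using assms by (auto simp: bounded_borel_def)
  moreover from this[of 0] have "C \<ge> 0" by linarith
  ultimately show ?thesis using that by blast
qed

lemma bounded_borel_const [simp, intro]: "bounded_borel (\<lambda>x. c)"
  by (rule bounded_borelI[where C="\<bar>c\<bar>"]) auto

lemma bounded_borel_indicator [simp, intro]: "A \<in> sets borel \<Longrightarrow> bounded_borel (indicator A)"
  by (rule bounded_borelI[where C=1]) (auto simp: indicator_def)

lemma bounded_borel_diff [intro]:
  assumes "bounded_borel a" "bounded_borel b" shows "bounded_borel (\<lambda>x. a x - b x)"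
proof -
  obtain C D where "\<And>x. \<bar>a x\<bar> \<le> C" "\<And>x. \<bar>b x\<bar> \<le> D"
    using assms by (auto simp: bounded_borel_def)
  then have "\<bar>a x - b x\<bar> \<le> C + D" for x
    by (meson abs_triangle_ineq4 add_mono order_trans)
  with assms show ?thesis by (intro bounded_borelI) (auto dest: bounded_borel_measurable)
qed

lemma bounded_borel_mult [intro]:
  assumes "bounded_borel a" "bounded_borel b" shows "bounded_borel (\<lambda>x. a x * b x)"
proof -
  obtain C D where "C \<ge> 0" "\<And>x. \<bar>a x\<bar> \<le> C" "\<And>x. \<bar>b x\<bar> \<le> D"
    using assms by (metis bounded_borelE)
  then have "\<bar>a x * b x\<bar> \<le> C * D" for x
    by (simp add: abs_mult mult_mono)
  with assms show ?thesis by (intro bounded_borelI) (auto dest: bounded_borel_measurable)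
qed

lemma integrable_bounded_borel:
  assumes "prob_space M" "sets M = sets borel" "bounded_borel h"
  shows "integrable M h"
proof -
  interpret prob_space M by fact
  obtain C where "\<And>x. \<bar>h x\<bar> \<le> C" using assms(3) by (auto simp: bounded_borel_def)
  then show ?thesis
    using assms(2,3) by (intro integrable_const_bound[where B=C])
      (auto simp: bounded_borel_def cong: measurable_cong_sets)
qed

section \<open>Reversible kernels: from a pointwise rate to a gap inequality for indicators\<close>

text \<open>Reversibility is encoded as self-adjointness on bounded functions rather than as
  symmetry of a measure on pairs. This is the form that Fubini delivers for a Gibbs sampler and that
  the spectral argument consumes.\<close>

locale reversible_kernel =
  fixes \<pi> :: "real measure" and K :: "real \<Rightarrow> real measure"
  assumes prob_pi: "prob_space \<pi>" and sets_pi: "sets \<pi> = sets borel"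
    and K_measurable: "K \<in> borel \<rightarrow>\<^sub>M prob_algebra borel"
    and reversible: "\<And>a b. bounded_borel a \<Longrightarrow> bounded_borel b \<Longrightarrow>
      (\<integral>\<theta>. (\<integral>\<eta>. a \<eta> \<partial>K \<theta>) * b \<theta> \<partial>\<pi>) = (\<integral>\<theta>. a \<theta> * (\<integral>\<eta>. b \<eta> \<partial>K \<theta>) \<partial>\<pi>)"
begin

definition T :: "(real \<Rightarrow> real) \<Rightarrow> real \<Rightarrow> real" where
  "T h \<theta> = (\<integral>\<eta>. h \<eta> \<partial>K \<theta>)"

definition ip :: "(real \<Rightarrow> real) \<Rightarrow> (real \<Rightarrow> real) \<Rightarrow> real" where
  "ip a b = (\<integral>\<theta>. a \<theta> * b \<theta> \<partial>\<pi>)"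

lemma prob_K: "prob_space (K \<theta>)" and sets_K: "sets (K \<theta>) = sets borel"
  using measurable_space[OF K_measurable, of \<theta>] by (auto simp: space_prob_algebra)

lemma T_bound:
  assumes "bounded_borel h" "\<And>x. \<bar>h x\<bar> \<le> C"
  shows "\<bar>T h \<theta>\<bar> \<le> C"
proof -
  interpret prob_space "K \<theta>" by (rule prob_K)
  have i: "integrable (K \<theta>) h" using prob_K sets_K assms(1) by (rule integrable_bounded_borel)
  have "h x \<le> C" "- C \<le> h x" for x using assms(2)[of x] by linarith+
  then have "T h \<theta> \<le> C" "T h \<theta> \<ge> - C"
    unfolding T_def using i by (auto intro!: integral_le_const integral_ge_const)
  then show ?thesis by linarith
qed

lemma bounded_borel_T [intro]: assumes "bounded_borel h" shows "bounded_borel (T h)"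
proof -
  obtain C where C: "\<And>x. \<bar>h x\<bar> \<le> C" using assms by (auto simp: bounded_borel_def)
  have [measurable]: "K \<in> borel \<rightarrow>\<^sub>M subprob_algebra borel"
    using K_measurable by (rule measurable_prob_algebraD)
  have "h \<in> borel_measurable borel" using assms by (rule bounded_borel_measurable)
  then have "T h \<in> borel_measurable borel"
    unfolding T_def[abs_def] 
    by (intro measurable_compose[OF _ integral_measurable_subprob_algebra]) auto
  from bounded_borelI[OF this T_bound[OF assms C]] show ?thesis .
qed

lemma bounded_borel_T_pow [intro]: "bounded_borel h \<Longrightarrow> bounded_borel ((T ^^ n) h)"
  by (induction n) auto

lemma T_diff: "bounded_borel a \<Longrightarrow> bounded_borel b \<Longrightarrow> T (\<lambda>x. a x - b x) = (\<lambda>x. T a x - T b x)"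
  unfolding T_def using integrable_bounded_borel[OF prob_K sets_K] by auto

lemma T_const [simp]: "T (\<lambda>x. c) = (\<lambda>x. c)"
  unfolding T_def using prob_space.prob_space[OF prob_K] by simp

lemma T_pow_diff_const:
  assumes "bounded_borel a" shows "(T ^^ n) (\<lambda>x. a x - c) = (\<lambda>x. (T ^^ n) a x - c)"
  by (induction n) (auto simp: T_diff[OF bounded_borel_T_pow[OF assms] bounded_borel_const])

lemma integrable_pi: "bounded_borel h \<Longrightarrow> integrable \<pi> h"
  by (rule integrable_bounded_borel[OF prob_pi sets_pi])

lemma ip_commute: "ip a b = ip b a"
  by (simp add: ip_def mult.commute)

lemma ip_diff_left: "bounded_borel a \<Longrightarrow> bounded_borel b \<Longrightarrow> bounded_borel c \<Longrightarrow> ip (\<lambda>x. a x - b x) c = ip a c - ip b c"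
  unfolding ip_def by (subst Bochner_Integration.integral_diff[symmetric])
    (auto intro!: integrable_pi simp: algebra_simps)

lemma ip_diff_right: "bounded_borel a \<Longrightarrow> bounded_borel b \<Longrightarrow> bounded_borel c \<Longrightarrow> ip c (\<lambda>x. a x - b x) = ip c a - ip c b"
  by (subst (1 2 3) ip_commute) (rule ip_diff_left)

lemma ip_mono:
  assumes "bounded_borel a" "bounded_borel b" "bounded_borel c" "bounded_borel d" "\<And>x. a x * b x \<le> c x * d x"
  shows "ip a b \<le> ip c d"
  unfolding ip_def using assms by (intro integral_mono integrable_pi) auto

lemma ip_T: "bounded_borel a \<Longrightarrow> bounded_borel b \<Longrightarrow> ip (T a) b = ip a (T b)"
  unfolding ip_def T_def by (rule reversible)

lemma ip_T_pow: "bounded_borel a \<Longrightarrow> bounded_borel b \<Longrightarrow> ip ((T ^^ n) a) b = ip a ((T ^^ n) b)"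
proof (induction n arbitrary: b)
  case (Suc n)
  have "ip ((T ^^ Suc n) a) b = ip ((T ^^ n) a) (T b)"
    using Suc.prems by (simp add: ip_T bounded_borel_T_pow)
  also have "\<dots> = ip a ((T ^^ Suc n) b)"
    using Suc by (simp add: bounded_borel_T funpow_swap1)
  finally show ?case .
qed simp

lemma ip_Cauchy_Schwarz:
  assumes a: "bounded_borel a" and b: "bounded_borel b"
  shows "(ip a b)\<^sup>2 \<le> ip a a * ip b b"
proof -
  \<comment> \<open>The quadratic form is kept homogeneous in \<open>s\<close> and \<open>t\<close>,
    so that \<open>s = ip b b\<close>, \<open>t = ip a b\<close> gives the claim times
    \<open>ip b b\<close> without dividing. If \<open>ip b b = 0\<close>, the form with
    \<open>s = 1\<close> is affine in \<open>t\<close>, and a suitable \<open>t\<close> makes it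
    equal to -1 unless \<open>ip a b = 0\<close>.\<close>
  have q: "0 \<le> ip a a * s\<^sup>2 - 2 * ip a b * s * t + ip b b * t\<^sup>2" for s t
  proof -
    have "0 \<le> (\<integral>x. (s * a x - t * b x)\<^sup>2 \<partial>\<pi>)" by simp
    also have "\<dots> = (\<integral>x. s\<^sup>2 * (a x * a x) - 2 * s * t * (a x * b x) + t\<^sup>2 * (b x * b x) \<partial>\<pi>)"
      by (simp add: power2_eq_square algebra_simps)
    also have "\<dots> = s\<^sup>2 * ip a a - 2 * s * t * ip a b + t\<^sup>2 * ip b b"
      unfolding ip_def using a b by (simp add: integrable_pi bounded_borel_mult)
    finally show ?thesis by (simp add: algebra_simps)
  qed
  show ?thesis
  proof (cases "ip b b = 0")
    case True
    have "ip a b = 0"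
    proof (rule ccontr)
      assume n: "ip a b \<noteq> 0"
      have "0 \<le> ip a a - 2 * ip a b * ((ip a a + 1) / (2 * ip a b))"
        using q[of 1 "(ip a a + 1) / (2 * ip a b)"] True by simp
      with n show False by (simp add: field_simps)
    qed
    with True show ?thesis by simp
  next
    case False
    have "0 \<le> ip b b" by (simp add: ip_def)
    with False have p: "0 < ip b b" by simp
    have "0 \<le> ip b b * (ip a a * ip b b - (ip a b)\<^sup>2)"
      using q[of "ip b b" "ip a b"] by (simp add: power2_eq_square algebra_simps)
    with p show ?thesis by (simp add: zero_le_mult_iff)
  qed
qed

abbreviation "p \<equiv> measure \<pi>"

lemma ip_indicator: 
  assumes "A \<in> sets borel" "B \<in> sets borel"
  shows "ip (indicator A) (indicator B) = p (A \<inter> B)"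
  using assms sets_pi by (simp add: ip_def flip: indicator_inter_arith)

lemma pi_UNIV: "p UNIV = 1"
  using prob_space.prob_space[OF prob_pi] sets_eq_imp_space_eq[OF sets_pi] by simp

text \<open>Two bounds on the stationary autocovariance \<open>a n\<close> of the indicator collide.
  Integrating the uniform rate over \<open>B\<close> bounds it by a multiple of
  \<open>r ^ n\<close>; if the claim failed, reversibility would keep it above a multiple of
  \<open>q ^ n\<close> with \<open>q = a 1 / a 0 > r\<close> whenever \<open>n\<close> is a power of
  two.\<close>

lemma rate_bound_on_uniform_set:
  assumes B[measurable]: "B \<in> sets borel" and r: "0 \<le> r"
    and C: "\<And>\<theta> n. \<theta> \<in> B \<Longrightarrow> n \<ge> 1 \<Longrightarrow> \<bar>(T ^^ n) (indicator B) \<theta> - p B\<bar> \<le> C * r ^ n"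
  shows "ip (T (indicator B)) (indicator B) - (p B)\<^sup>2 \<le> r * (p B - (p B)\<^sup>2)"
proof (rule ccontr)
  define \<beta> where "\<beta> = p B"
  define h where "h = (\<lambda>x. indicator B x - \<beta>)"
  define a where "a n = ip ((T ^^ n) h) h" for n
  have \<beta>: "0 \<le> \<beta>" by (simp add: \<beta>_def)
  have bh: "bounded_borel h" unfolding h_def by auto
  have ipc: "ip k (\<lambda>x. c) = c * ip k (\<lambda>x. 1)" for k c
    by (simp add: ip_def mult.commute)
  have h0: "ip h (\<lambda>x. 1) = 0"
    unfolding h_def by (subst ip_diff_left)
      (use B sets_pi pi_UNIV sets_eq_imp_space_eq[OF sets_pi] in
        \<open>auto simp: ip_def \<beta>_def prob_space.prob_space[OF prob_pi]\<close>)
  have T1: "(T ^^ n) (\<lambda>x. 1) = (\<lambda>x. 1)" for n by (induction n) auto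
  have Th0: "ip ((T ^^ n) h) (\<lambda>x. c) = 0" for n c
    using ipc[of "(T ^^ n) h" c] ip_T_pow[OF bh bounded_borel_const[of 1], of n] h0 by (simp add: T1)
  \<comment> \<open>\<open>T ^^ n\<close> preserves mean zero, so the second \<open>h\<close> may be
    replaced by the indicator of \<open>B\<close>. Only starting points in \<open>B\<close> then
    contribute, and there the constant \<open>C\<close> is available.\<close>
  have an: "a n = ip ((T ^^ n) h) (indicator B)" for n
    using ip_diff_right[OF bounded_borel_indicator[OF B] bounded_borel_const bounded_borel_T_pow[OF bh], of n \<beta>]
    by (simp add: a_def h_def[symmetric] Th0)
  have an': "a n = ip ((T ^^ n) (indicator B)) (indicator B) - \<beta>\<^sup>2" for n
  proof -
    have "ip ((T ^^ n) h) (indicator B) = ip ((T ^^ n) (indicator B)) (indicator B) - ip (\<lambda>x. \<beta>) (indicator B)"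
      unfolding h_def T_pow_diff_const[OF bounded_borel_indicator[OF B]] by (rule ip_diff_left) auto
    also have "ip (\<lambda>x. \<beta>) (indicator B) = \<beta>\<^sup>2"
      using B sets_pi by (simp add: ip_def \<beta>_def power2_eq_square)
    finally show ?thesis by (simp add: an)
  qed
  have upper: "a n \<le> C * r ^ n * \<beta>" if "n \<ge> 1" for n
  proof -
    have "a n \<le> ip (\<lambda>x. C * r ^ n) (indicator B)"
      unfolding an
    proof (rule ip_mono)
      show "(T ^^ n) h x * indicator B x \<le> C * r ^ n * indicator B x" for x
        using C[of x n] that unfolding h_def T_pow_diff_const[OF bounded_borel_indicator[OF B]] \<beta>_def
        by (auto simp: indicator_def)
    qed (use bh in auto)
    also have "\<dots> = C * r ^ n * \<beta>"
      using B sets_pi by (simp add: ip_def \<beta>_def)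
    finally show ?thesis .
  qed
  have sq: "(a n)\<^sup>2 \<le> a (2 * n) * a 0" for n
  proof -
    have "a (2 * n) = ip ((T ^^ n) h) ((T ^^ n) h)"
      using bh ip_T_pow[of "(T ^^ n) h" h n] by (simp add: a_def mult_2 funpow_add bounded_borel_T_pow)
    then show ?thesis
      using ip_Cauchy_Schwarz[OF bounded_borel_T_pow[OF bh] bh, of n] by (simp add: a_def)
  qed
  assume "\<not> ?thesis"
  moreover have "ip (indicator B) (indicator B) = \<beta>" using ip_indicator[OF B B] by (simp add: \<beta>_def)
  ultimately have gt: "a 1 > r * a 0"
    using an'[of 0] an'[of 1] by (simp add: \<beta>_def)
  have "a 0 \<ge> 0" by (simp add: a_def ip_def)
  moreover have "a 0 \<noteq> 0" using sq[of 1] gt by auto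
  ultimately have a0: "a 0 > 0" by simp
  define q where "q = a 1 / a 0"
  have q: "r < q" "0 < q" using gt a0 r unfolding q_def
    by (simp_all add: field_simps) (meson less_eq_real_def mult_nonneg_nonneg order_le_less_trans)
  \<comment> \<open>\<open>a (2 n) = \<parallel>T\<^sup>n h\<parallel>\<^sup>2\<close>, so Cauchy--Schwarz along powers of two makes \<open>a\<close> decay no faster than
    \<open>q\<^sup>n\<close>, without any spectral theory.\<close>
  have lower: "a 0 * q ^ (2 ^ k) \<le> a (2 ^ k)" for k
  proof (induction k)
    case 0
    then show ?case using a0 by (simp add: q_def)
  next
    case (Suc k)
    have "(a 0 * q ^ (2 ^ k))\<^sup>2 \<le> (a (2 ^ k))\<^sup>2"
      using Suc a0 q by (intro power_mono) auto
    also have "\<dots> \<le> a (2 ^ Suc k) * a 0" using sq[of "2 ^ k"] by simp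
    also have "(a 0 * q ^ (2 ^ k))\<^sup>2 = (a 0 * q ^ (2 ^ Suc k)) * a 0"
      by (simp add: power2_eq_square algebra_simps mult_2 power_add)
    finally show ?case using a0 by (simp add: mult.commute)
  qed
  have "a 0 \<le> C * \<beta> * (r / q) ^ (2 ^ k)" for k
  proof -
    have "a 0 * q ^ (2 ^ k) \<le> C * r ^ (2 ^ k) * \<beta>"
      using lower[of k] upper[of "2 ^ k"] by simp
    then show ?thesis using q by (simp add: field_simps power_divide)
  qed
  moreover have "(\<lambda>k. C * \<beta> * (r / q) ^ (2 ^ k)) \<longlonglongrightarrow> C * \<beta> * 0"
  proof (intro tendsto_mult tendsto_const)
    have "(\<lambda>n. (r / q) ^ n) \<longlonglongrightarrow> 0"
      using q r by (intro LIMSEQ_power_zero) (auto simp: field_simps)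
    from LIMSEQ_subseq_LIMSEQ[OF this, of "\<lambda>k. 2 ^ k"]
    show "(\<lambda>k. (r / q) ^ (2 ^ k)) \<longlonglongrightarrow> 0" by (simp add: strict_mono_def o_def)
  qed
  ultimately have "a 0 \<le> C * \<beta> * 0" by (intro LIMSEQ_le_const) auto
  with a0 show False by simp
qed

text \<open>With \<open>D = A - B\<close>, self-adjointness turns the difference of the two inner
  products into two terms paired with the indicator of \<open>D\<close>. Each is at most
  \<open>p D\<close>, since \<open>T\<close> maps indicators to functions bounded by 1.\<close>

lemma ip_T_indicator_subset:
  assumes A: "A \<in> sets borel" and B: "B \<in> sets borel" and sub: "B \<subseteq> A"
  shows "ip (T (indicator A)) (indicator A) \<le> ip (T (indicator B)) (indicator B) + 2 * (p A - p B)"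
proof -
  define D where "D = A - B"
  have D: "D \<in> sets borel" using A B by (simp add: D_def)
  interpret prob_space \<pi> by (rule prob_pi)
  have pD: "p D = p A - p B"
    unfolding D_def using A B sub sets_pi by (intro finite_measure_Diff) auto
  have iD: "indicator D = (\<lambda>x. indicator A x - indicator B x :: real)"
    using sub by (intro ext) (auto simp: D_def indicator_def)
  have le: "ip (T (indicator E)) (indicator D) \<le> p D" if E: "E \<in> sets borel" for E
  proof -
    have T1: "T (indicator E) x \<le> 1" for x
      using T_bound[of "indicator E" 1 x] E by (auto simp: indicator_def)
    have "ip (T (indicator E)) (indicator D) \<le> ip (\<lambda>x. 1) (indicator D)"
      using E D T1 by (intro ip_mono) (auto simp: indicator_def)
    also have "\<dots> = p D" using D sets_pi by (simp add: ip_def)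
    finally show ?thesis .
  qed
  have "ip (T (indicator A)) (indicator A) - ip (T (indicator B)) (indicator B)
     = ip (T (indicator A)) (indicator D) + ip (T (indicator B)) (indicator D)"
    using A B ip_T[of "indicator A" "indicator B"] ip_commute[of "indicator A" "T (indicator B)"]
    by (simp add: iD ip_diff_right bounded_borel_T)
  also have "\<dots> \<le> 2 * p D" using le[OF A] le[OF B] by simp
  finally show ?thesis by (simp add: pD)
qed

lemma pointwise_rate_imp_gap:
  assumes I: "I \<in> sets borel" and r: "0 \<le> r"
    and feller: "\<And>h. bounded_borel h \<Longrightarrow> continuous_on UNIV (T h)"
    and rate: "\<And>\<theta>. \<exists>C. \<forall>n\<ge>1. \<forall>A\<in>sets borel. \<bar>(T ^^ n) (indicator A) \<theta> - p A\<bar> \<le> C * r ^ n"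
  shows "ip (T (indicator I)) (indicator I) - (p I)\<^sup>2 \<le> r * (p I - (p I)\<^sup>2)"
proof -
  \<comment> \<open>The constant in the rate need not depend measurably on the starting point; the Feller property
    makes the sets where it is at most \<open>k\<close> closed.\<close>
  define D where "D k = {\<theta>. \<forall>n\<ge>1. \<forall>A\<in>sets borel. \<bar>(T ^^ n) (indicator A) \<theta> - p A\<bar> \<le> real k * r ^ n}"
    for k
  define B where "B k = I \<inter> D k" for k
  have "closed (D k)" for k
  proof -
    \<comment> \<open>Here \<open>n \<ge> 1\<close> matters: \<open>T ^^ 0\<close> leaves the
      indicator discontinuous, while a last application of \<open>T\<close> makes it
      continuous.\<close>
    have "continuous_on UNIV ((T ^^ n) (indicator A))" if "n \<ge> 1" "A \<in> sets borel" for n A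
      using that feller[OF bounded_borel_T_pow[of "indicator A" "n - 1"]] by (cases n) auto
    moreover have "D k = (\<Inter>n\<in>{1..}. \<Inter>A\<in>sets borel.
        {\<theta>. \<bar>(T ^^ n) (indicator A) \<theta> - p A\<bar> \<le> real k * r ^ n})"
      by (auto simp: D_def)
    ultimately show ?thesis
      by (auto intro!: closed_INT closed_Collect_le continuous_intros)
  qed
  then have B: "B k \<in> sets borel" for k
    using I by (auto simp: B_def)
  have "D i \<subseteq> D k" if "i \<le> k" for i k
  proof -
    have "real i * r ^ n \<le> real k * r ^ n" for n using r that by (intro mult_right_mono) auto
    then show ?thesis unfolding D_def by (blast intro: order_trans)
  qed
  then have "incseq B" by (auto simp: incseq_def B_def)
  moreover have "(\<Union>k. B k) = I"
  proof -
    have "\<exists>k. \<theta> \<in> D k" for \<theta>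
    proof -
      obtain C where C: "\<And>n A. n \<ge> 1 \<Longrightarrow> A \<in> sets borel \<Longrightarrow> \<bar>(T ^^ n) (indicator A) \<theta> - p A\<bar> \<le> C * r ^ n"
        using rate[of \<theta>] by blast
      obtain k :: nat where "C \<le> real k" using real_arch_simple by blast
      then have "C * r ^ n \<le> real k * r ^ n" for n using r by (intro mult_right_mono) auto
      with C have "\<theta> \<in> D k" unfolding D_def by (blast intro: order_trans)
      then show ?thesis ..
    qed
    then show ?thesis by (auto simp: B_def)
  qed
  moreover interpret prob_space \<pi> by (rule prob_pi)
  have "range B \<subseteq> sets \<pi>" using B sets_pi by auto
  ultimately have lim: "(\<lambda>k. p (B k)) \<longlonglongrightarrow> p I"
    using finite_Lim_measure_incseq[of B] by simp
  \<comment> \<open>The gap inequality for \<open>B k\<close> says nothing direct about the larger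
    set \<open>I\<close>; the price of enlarging the set is an error term that vanishes as
    \<open>p (B k)\<close> tends to \<open>p I\<close>.\<close>
  have bound: "ip (T (indicator I)) (indicator I) \<le>
      r * (p (B k) - (p (B k))\<^sup>2) + (p (B k))\<^sup>2 + 2 * (p I - p (B k))" for k
  proof -
    have "ip (T (indicator (B k))) (indicator (B k)) - (p (B k))\<^sup>2 \<le> r * (p (B k) - (p (B k))\<^sup>2)"
    proof (rule rate_bound_on_uniform_set[OF B r])
      show "\<bar>(T ^^ n) (indicator (B k)) \<theta> - p (B k)\<bar> \<le> real k * r ^ n" 
        if "\<theta> \<in> B k" "n \<ge> 1" for \<theta> n
        using that B[of k] unfolding B_def D_def by blast
    qed
    moreover have "ip (T (indicator I)) (indicator I)
        \<le> ip (T (indicator (B k))) (indicator (B k)) + 2 * (p I - p (B k))"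
      using I B by (intro ip_T_indicator_subset) (auto simp: B_def)
    ultimately show ?thesis by linarith
  qed
  have "(\<lambda>k. r * (p (B k) - (p (B k))\<^sup>2) + (p (B k))\<^sup>2 + 2 * (p I - p (B k)))
      \<longlonglongrightarrow> r * (p I - (p I)\<^sup>2) + (p I)\<^sup>2 + 2 * (p I - p I)"
    by (intro tendsto_intros lim)
  from LIMSEQ_le_const[OF this] bound show ?thesis by fastforce
qed

end

section \<open>Markov kernels given by densities\<close>

lemma density_prob_kernel:
  assumes k[measurable]: "case_prod k \<in> borel_measurable (borel \<Otimes>\<^sub>M (borel :: real measure))"
    and nn: "\<And>x u. k x u \<ge> 0"
    and int: "\<And>x. integrable lborel (k x)" and one: "\<And>x. (\<integral>u. k x u \<partial>lborel) = 1"
  shows "(\<lambda>x::real. density lborel (\<lambda>u::real. ennreal (k x u))) \<in> borel \<rightarrow>\<^sub>M prob_algebra borel"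
proof (rule measurable_prob_algebraI)
  show prob: "prob_space (density lborel (\<lambda>u. ennreal (k x u)))" for x
    using int[of x] one[of x] nn
    by (intro prob_spaceI) (simp add: emeasure_density nn_integral_eq_integral)
  show "(\<lambda>x. density lborel (\<lambda>u. ennreal (k x u))) \<in> borel \<rightarrow>\<^sub>M subprob_algebra borel"
  proof (rule measurable_subprob_algebra)
    show "subprob_space (density lborel (\<lambda>u. ennreal (k x u)))" for x
      using prob by (rule prob_space_imp_subprob_space)
    show "(\<lambda>x. emeasure (density lborel (\<lambda>u. ennreal (k x u))) A) \<in> borel_measurable borel"
      if [measurable]: "A \<in> sets borel" for A
    proof -
      have "emeasure (density lborel (\<lambda>u. ennreal (k x u))) A =
          (\<integral>\<^sup>+u. ennreal (k x u) * indicator A u \<partial>lborel)" for x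
        by (subst emeasure_density) auto
      then show ?thesis by simp
    qed
  qed auto
qed

section \<open>The centred Gibbs sampler and its reversibility\<close>

text \<open>The densities have neutral names because the locale is used in both orders: with
  \<open>f1\<close>, \<open>f2\<close> for the centred sampler and with \<open>f2\<close>,
  \<open>f1\<close> for the non-centred one.\<close>

locale flat_gibbs =
  fixes f g :: "real \<Rightarrow> real" and y :: real
  assumes f: "good_density f" and g: "good_density g"
begin

lemma f_cont: "continuous_on UNIV f" and f_pos: "f x > 0" and f_sym: "f (- x) = f x"
  and f_int: "integrable lborel f" and f_one: "(\<integral>x. f x \<partial>lborel) = 1"
  using f by (auto simp: good_density_def)

lemma g_cont: "continuous_on UNIV g" and g_pos: "g x > 0"
  and g_int: "integrable lborel g" and g_one: "(\<integral>x. g x \<partial>lborel) = 1"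
  using g by (auto simp: good_density_def)

lemma f_measurable [measurable]: "f \<in> borel_measurable borel"
  using f_cont by (rule borel_measurable_continuous_onI)

lemma g_measurable [measurable]: "g \<in> borel_measurable borel"
  using g_cont by (rule borel_measurable_continuous_onI)

lemma f_shift: "integrable lborel (\<lambda>x. f (t - x))" "(\<integral>x. f (t - x) \<partial>lborel) = 1"
  using lborel_integrable_real_affine[OF f_int, of "-1" t] 
    lborel_integral_real_affine[of "-1" f t] f_one by auto

lemma g_shift: "integrable lborel (\<lambda>x. g (t - x))" "(\<integral>x. g (t - x) \<partial>lborel) = 1"
  using lborel_integrable_real_affine[OF g_int, of "-1" t] 
    lborel_integral_real_affine[of "-1" g t] g_one by auto

definition G where "G = (SUP x. g x)"

lemma g_le: "g x \<le> G"
proof -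
  have "bounded (range g)" using g by (simp add: good_density_def)
  then show ?thesis unfolding G_def
    by (intro cSUP_upper) (auto intro: bounded_imp_bdd_above)
qed

definition w where "w x \<theta> = f (y - x) * g (x - \<theta>)"

definition m where "m \<theta> = (\<integral>x. w x \<theta> \<partial>lborel)"

lemma w_pos: "w x \<theta> > 0" by (simp add: w_def f_pos g_pos)

lemma w_measurable [measurable]: "(\<lambda>(x, \<theta>). w x \<theta>) \<in> borel_measurable (borel \<Otimes>\<^sub>M borel)"
  unfolding w_def by measurable

lemma w_le: "w x \<theta> \<le> G * f (y - x)"
  using g_le f_pos[of "y - x"] by (simp add: w_def mult.commute)

text \<open>Because \<open>g\<close> is bounded, the integrand is dominated by a multiple of
  \<open>f (y - x)\<close>, which does not involve \<theta>; dominated convergence then yields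
  continuity. This is the source of the Feller property.\<close>

lemma continuous_weighted_integral:
  assumes "bounded_borel h"
  shows "continuous_on UNIV (\<lambda>\<theta>. \<integral>x. h x * w x \<theta> \<partial>lborel)" 
    and "integrable lborel (\<lambda>x. h x * w x \<theta>)"
proof -
  obtain C where C: "C \<ge> 0" "\<And>x. \<bar>h x\<bar> \<le> C" using bounded_borelE[OF assms] by blast
  have [measurable]: "h \<in> borel_measurable borel" using assms by (rule bounded_borel_measurable)
  have b: "norm (h x * w x \<theta>) \<le> C * (G * f (y - x))" for x \<theta>
    using C w_pos[of x \<theta>] w_le[of x \<theta>] by (simp add: abs_mult mult_mono)
  have i: "integrable lborel (\<lambda>x. C * (G * f (y - x)))" using f_shift by simp
  show "integrable lborel (\<lambda>x. h x * w x \<theta>)"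
    using i by (rule Bochner_Integration.integrable_bound) (use b in \<open>auto intro!: AE_I2 order_trans[OF _ abs_ge_self]\<close>)
  show "continuous_on UNIV (\<lambda>\<theta>. \<integral>x. h x * w x \<theta> \<partial>lborel)"
  proof (rule continuous_on_sequentiallyI)
    fix u :: "nat \<Rightarrow> real" and a assume u: "u \<longlonglongrightarrow> a"
    show "(\<lambda>n. \<integral>x. h x * w x (u n) \<partial>lborel) \<longlonglongrightarrow> (\<integral>x. h x * w x a \<partial>lborel)"
    proof (rule integral_dominated_convergence[OF _ _ i])
      show "AE x in lborel. (\<lambda>n. h x * w x (u n)) \<longlonglongrightarrow> h x * w x a"
        unfolding w_def
        by (intro AE_I2 tendsto_intros u continuous_on_tendsto_compose[OF g_cont]) auto
    qed (use b in auto)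
  qed
qed

lemma w_int: "integrable lborel (\<lambda>x. w x \<theta>)"
  using continuous_weighted_integral(2)[of "\<lambda>x. 1"] by simp

lemma m_cont: "continuous_on UNIV m"
  using continuous_weighted_integral(1)[of "\<lambda>x. 1"] by (simp add: m_def[abs_def])

lemma m_measurable [measurable]: "m \<in> borel_measurable borel"
  using m_cont by (rule borel_measurable_continuous_onI)

lemma m_pos: "m \<theta> > 0"
proof -
  have "m \<theta> \<noteq> 0"
  proof
    assume "m \<theta> = 0"
    then have "AE x in lborel. w x \<theta> = 0"
      unfolding m_def using w_pos 
      by (subst (asm) integral_nonneg_eq_0_iff_AE[OF w_int]) (auto simp: less_imp_le)
    then have "AE x::real in lborel. False"
      by (rule eventually_mono) (use w_pos in \<open>simp add: less_imp_neq[symmetric]\<close>)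
    then show False by (simp add: AE_iff_null null_sets_def)
  qed
  moreover have "m \<theta> \<ge> 0" unfolding m_def using w_pos by (intro Bochner_Integration.integral_nonneg) (simp add: less_imp_le)
  ultimately show ?thesis by simp
qed

lemma w_pair_int: "integrable (lborel \<Otimes>\<^sub>M lborel) (\<lambda>(x, \<theta>). w x \<theta>)"
proof (rule lborel_pair.Fubini_integrable)
  show "(\<lambda>(x, \<theta>). w x \<theta>) \<in> borel_measurable (lborel \<Otimes>\<^sub>M lborel)" by measurable
  have "(\<integral>\<theta>. norm (case (x, \<theta>) of (x, \<theta>) \<Rightarrow> w x \<theta>) \<partial>lborel) = f (y - x)" for x
    using w_pos[of x] g_shift[of x] by (simp add: w_def abs_of_pos)
  then show "integrable lborel (\<lambda>x. \<integral>\<theta>. norm (case (x, \<theta>) of (x, \<theta>) \<Rightarrow> w x \<theta>) \<partial>lborel)"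
    using f_shift by simp
  show "AE x in lborel. integrable lborel (\<lambda>\<theta>. case (x, \<theta>) of (x, \<theta>) \<Rightarrow> w x \<theta>)"
    using g_shift by (simp add: w_def)
qed

text \<open>\<open>F\<close> and \<open>E\<close> are the two half-steps of the sampler as
  conditional expectations: \<open>F h x\<close> averages over \<Theta> given X = x, and
  \<open>E h \<theta>\<close> averages over X given \<Theta> = \<theta>. In \<open>F\<close> the
  factor \<open>f (y - x)\<close> has cancelled against the normalising constant.\<close>

definition F :: "(real \<Rightarrow> real) \<Rightarrow> real \<Rightarrow> real" where
  "F h x = (\<integral>\<eta>. h \<eta> * g (x - \<eta>) \<partial>lborel)"

definition E :: "(real \<Rightarrow> real) \<Rightarrow> real \<Rightarrow> real" where
  "E h \<theta> = (\<integral>x. h x * w x \<theta> \<partial>lborel) / m \<theta>"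

lemma integrable_F: assumes "bounded_borel h" shows "integrable lborel (\<lambda>\<eta>. h \<eta> * g (x - \<eta>))"
proof -
  obtain C where C: "C \<ge> 0" "\<And>x. \<bar>h x\<bar> \<le> C" using bounded_borelE[OF assms] by blast
  have "integrable lborel (\<lambda>\<eta>. C * g (x - \<eta>))" using g_shift by simp
  then show ?thesis
    by (rule Bochner_Integration.integrable_bound)
      (use C assms g_pos in \<open>auto simp: abs_mult bounded_borel_def less_imp_le intro!: mult_right_mono\<close>)
qed

lemma F_bound: assumes "bounded_borel h" "\<And>x. \<bar>h x\<bar> \<le> C" shows "\<bar>F h x\<bar> \<le> C"
proof -
  have "\<bar>F h x\<bar> \<le> (\<integral>\<eta>. \<bar>h \<eta> * g (x - \<eta>)\<bar> \<partial>lborel)" 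
    unfolding F_def by (rule integral_abs_bound)
  also have "\<dots> \<le> (\<integral>\<eta>. C * g (x - \<eta>) \<partial>lborel)"
  proof (rule integral_mono)
    show "integrable lborel (\<lambda>\<eta>. \<bar>h \<eta> * g (x - \<eta>)\<bar>)" using integrable_F[OF assms(1)] by simp
    show "\<bar>h \<eta> * g (x - \<eta>)\<bar> \<le> C * g (x - \<eta>)" for \<eta>
      using assms(2) g_pos[of "x - \<eta>"] by (simp add: abs_mult mult_right_mono)
  qed (use g_shift in simp)
  also have "\<dots> = C" using g_shift by simp
  finally show ?thesis .
qed

lemma bounded_borel_F [intro]: assumes "bounded_borel h" shows "bounded_borel (F h)"
proof -
  obtain C where C: "\<And>x. \<bar>h x\<bar> \<le> C" using assms by (auto simp: bounded_borel_def)
  have [measurable]: "h \<in> borel_measurable borel" using assms by (rule bounded_borel_measurable)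
  have "F h \<in> borel_measurable borel" unfolding F_def[abs_def] by measurable
  from bounded_borelI[OF this F_bound[OF assms C]] show ?thesis .
qed

text \<open>Integrating \<theta> out first leaves the probability density \<open>f (y - x)\<close>,
  so \<open>m\<close> is already the normalised posterior density.\<close>

lemma m_int: "integrable lborel m" and m_one: "(\<integral>\<theta>. m \<theta> \<partial>lborel) = 1"
proof -
  show "integrable lborel m"
    using lborel_pair.integrable_snd[OF w_pair_int] by (simp add: m_def[abs_def])
  have "(\<integral>\<theta>. m \<theta> \<partial>lborel) = (\<integral>x. \<integral>\<theta>. w x \<theta> \<partial>lborel \<partial>lborel)"
    unfolding m_def by (rule lborel_pair.Fubini_integral) (rule w_pair_int)
  then show "(\<integral>\<theta>. m \<theta> \<partial>lborel) = 1" by (simp add: w_def g_shift f_shift)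
qed

text \<open>\<open>E\<close> and \<open>F\<close> are adjoint to each other between the posterior of
  \<Theta> and the posterior of X, whose density is \<open>f (y - x)\<close>. Hence
  \<open>T\<close>, which is \<open>E\<close> after \<open>F\<close>, is an operator composed with
  its adjoint, and reversibility follows.\<close>

lemma ip_E:
  assumes c: "bounded_borel c" and b: "bounded_borel b"
  shows "(\<integral>\<theta>. m \<theta> * (E c \<theta> * b \<theta>) \<partial>lborel) = (\<integral>x. c x * F b x * f (y - x) \<partial>lborel)"
proof -
  obtain C where C: "C \<ge> 0" "\<And>x. \<bar>c x\<bar> \<le> C" using bounded_borelE[OF c] by blast
  obtain D where D: "D \<ge> 0" "\<And>x. \<bar>b x\<bar> \<le> D" using bounded_borelE[OF b] by blast
  have [measurable]: "c \<in> borel_measurable borel" "b \<in> borel_measurable borel"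
    using c b by (simp_all add: bounded_borel_def)
  have "\<bar>c x * b \<theta>\<bar> \<le> C * D" for x \<theta> using C D by (simp add: abs_mult mult_mono)
  then have bd: "norm (c x * b \<theta> * w x \<theta>) \<le> C * D * w x \<theta>" for x \<theta>
    using w_pos[of x \<theta>] by (simp add: abs_mult[of _ "w x \<theta>"] mult_right_mono)
  have "integrable (lborel \<Otimes>\<^sub>M lborel) (\<lambda>(x, \<theta>). C * D * w x \<theta>)"
    using w_pair_int by (simp add: case_prod_unfold)
  then have "integrable (lborel \<Otimes>\<^sub>M lborel) (\<lambda>(x, \<theta>). c x * b \<theta> * w x \<theta>)"
    by (rule Bochner_Integration.integrable_bound) (use bd in \<open>auto intro!: AE_I2 order_trans[OF _ abs_ge_self]\<close>)
  note * = lborel_pair.Fubini_integral[OF this]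
  have "(\<integral>\<theta>. m \<theta> * (E c \<theta> * b \<theta>) \<partial>lborel) = (\<integral>\<theta>. \<integral>x. c x * b \<theta> * w x \<theta> \<partial>lborel \<partial>lborel)"
  proof (rule Bochner_Integration.integral_cong[OF refl])
    fix \<theta>
    have "(\<integral>x. c x * b \<theta> * w x \<theta> \<partial>lborel) = (\<integral>x. b \<theta> * (c x * w x \<theta>) \<partial>lborel)"
      by (simp add: mult_ac)
    then show "m \<theta> * (E c \<theta> * b \<theta>) = (\<integral>x. c x * b \<theta> * w x \<theta> \<partial>lborel)"
      using m_pos[of \<theta>] by (simp add: E_def)
  qed
  also have "\<dots> = (\<integral>x. \<integral>\<theta>. c x * b \<theta> * w x \<theta> \<partial>lborel \<partial>lborel)" by (rule *)
  also have "\<dots> = (\<integral>x. c x * F b x * f (y - x) \<partial>lborel)"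
  proof (rule Bochner_Integration.integral_cong[OF refl])
    fix x
    have "(\<integral>\<theta>. c x * b \<theta> * w x \<theta> \<partial>lborel) = (\<integral>\<theta>. (c x * f (y - x)) * (b \<theta> * g (x - \<theta>)) \<partial>lborel)"
      by (simp add: w_def mult_ac)
    also have "\<dots> = c x * F b x * f (y - x)" by (simp add: F_def)
    finally show "(\<integral>\<theta>. c x * b \<theta> * w x \<theta> \<partial>lborel) = c x * F b x * f (y - x)" .
  qed
  finally show ?thesis .
qed

lemma cond_Theta_eq: "cond_Theta (joint0 f g y) x = density lborel (\<lambda>\<theta>. ennreal (g (x - \<theta>)))"
  using f_pos[of "y - x"] g_shift[of x] by (simp add: cond_Theta_def normdens_def joint0_def)

lemma cond_U_eq: "cond_U (joint0 f g y) \<theta> = density lborel (\<lambda>x. ennreal (w x \<theta> / m \<theta>))"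
  by (simp add: cond_U_def normdens_def joint0_def w_def m_def)

lemma post_eq: "post_Theta (joint0 f g y) = density lborel (\<lambda>\<theta>. ennreal (m \<theta>))"
  using m_one by (simp add: post_Theta_def normdens_def joint0_def w_def[symmetric] m_def[symmetric])

lemma cond_Theta_kernel: "cond_Theta (joint0 f g y) \<in> borel \<rightarrow>\<^sub>M prob_algebra borel"
  unfolding cond_Theta_eq[abs_def]
  by (rule density_prob_kernel) (use g_shift g_pos in \<open>auto simp: less_imp_le\<close>)

lemma cond_U_kernel: "cond_U (joint0 f g y) \<in> borel \<rightarrow>\<^sub>M prob_algebra borel"
  unfolding cond_U_eq[abs_def]
proof (rule density_prob_kernel)
  show "0 \<le> w x \<theta> / m \<theta>" for x \<theta> using w_pos[of x \<theta>] m_pos[of \<theta>] by simp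
  show "integrable lborel (\<lambda>u. w u x / m x)" for x using w_int by simp
  show "(\<integral>u. w u x / m x \<partial>lborel) = 1" for x using m_pos[of x] by (simp add: m_def)
qed measurable

lemma gibbs_kernel_kernel: "gibbs_kernel (joint0 f g y) \<in> borel \<rightarrow>\<^sub>M prob_algebra borel"
  unfolding gibbs_kernel_def[abs_def]
  using cond_U_kernel cond_Theta_kernel by measurable

lemma integral_cond_Theta: "bounded_borel h \<Longrightarrow> (\<integral>\<theta>. h \<theta> \<partial>cond_Theta (joint0 f g y) x) = F h x"
  unfolding cond_Theta_eq F_def using g_pos
  by (subst integral_density) (auto simp: bounded_borel_def less_imp_le mult.commute)

lemma integral_cond_U: "bounded_borel h \<Longrightarrow> (\<integral>x. h x \<partial>cond_U (joint0 f g y) \<theta>) = E h \<theta>"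
  unfolding cond_U_eq E_def using w_pos m_pos
  by (subst integral_density) (auto simp: bounded_borel_def less_imp_le mult.commute)

lemma integral_gibbs_kernel:
  assumes "bounded_borel h"
  shows "(\<integral>\<eta>. h \<eta> \<partial>gibbs_kernel (joint0 f g y) \<theta>) = E (F h) \<theta>"
proof -
  obtain C where C: "\<And>x. \<bar>h x\<bar> \<le> C" using assms by (auto simp: bounded_borel_def)
  have U: "prob_space (cond_U (joint0 f g y) \<theta>)" "sets (cond_U (joint0 f g y) \<theta>) = sets borel"
    using measurable_space[OF cond_U_kernel, of \<theta>] by (auto simp: space_prob_algebra)
  have V: "prob_space (cond_Theta (joint0 f g y) x)" for x
    using measurable_space[OF cond_Theta_kernel, of x] by (auto simp: space_prob_algebra)
  have "(\<integral>\<eta>. h \<eta> \<partial>gibbs_kernel (joint0 f g y) \<theta>) =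
      (\<integral>x. (\<integral>\<eta>. h \<eta> \<partial>cond_Theta (joint0 f g y) x) \<partial>cond_U (joint0 f g y) \<theta>)"
    unfolding gibbs_kernel_def
  proof (rule integral_bind[where K=borel and B=C and B'=1])
    show "cond_Theta (joint0 f g y) \<in> cond_U (joint0 f g y) \<theta> \<rightarrow>\<^sub>M subprob_algebra borel"
      using measurable_prob_algebraD[OF cond_Theta_kernel] U(2) by (simp cong: measurable_cong_sets)
    show "finite_measure (cond_U (joint0 f g y) \<theta>)" using U(1) by (rule prob_space.finite_measure)
  qed (use assms C V in \<open>auto simp: bounded_borel_def prob_space.emeasure_space_1\<close>)
  also have "\<dots> = (\<integral>x. F h x \<partial>cond_U (joint0 f g y) \<theta>)"
    using assms by (simp add: integral_cond_Theta)
  also have "\<dots> = E (F h) \<theta>" using assms by (intro integral_cond_U) auto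
  finally show ?thesis .
qed

lemma integral_post: "h \<in> borel_measurable borel \<Longrightarrow> (\<integral>\<theta>. h \<theta> \<partial>post_Theta (joint0 f g y)) = (\<integral>\<theta>. m \<theta> * h \<theta> \<partial>lborel)"
  unfolding post_eq using m_pos by (subst integral_density) (auto simp: less_imp_le)

lemma E_cont: assumes "bounded_borel h" shows "continuous_on UNIV (E h)"
  unfolding E_def[abs_def] using m_pos
  by (intro continuous_on_divide continuous_weighted_integral(1) m_cont assms) (auto simp: less_imp_neq[symmetric])

lemma bounded_borel_E: assumes "bounded_borel h" shows "E h \<in> borel_measurable borel"
  using E_cont[OF assms] by (rule borel_measurable_continuous_onI)

sublocale reversible_kernel "post_Theta (joint0 f g y)" "gibbs_kernel (joint0 f g y)"
proof (rule reversible_kernel.intro)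
  show "gibbs_kernel (joint0 f g y) \<in> borel \<rightarrow>\<^sub>M prob_algebra borel" by (rule gibbs_kernel_kernel)
  show "sets (post_Theta (joint0 f g y)) = sets borel" by (simp add: post_eq)
  show "prob_space (post_Theta (joint0 f g y))"
    using m_int m_one m_pos
    by (intro prob_spaceI) (simp add: post_eq emeasure_density nn_integral_eq_integral less_imp_le)
  fix a b assume a: "bounded_borel a" and b: "bounded_borel b"
  have [measurable]: "a \<in> borel_measurable borel" "b \<in> borel_measurable borel"
    "E (F a) \<in> borel_measurable borel" "E (F b) \<in> borel_measurable borel"
    using a b bounded_borel_E[OF bounded_borel_F] by (auto simp: bounded_borel_def)
  have "(\<integral>\<theta>. m \<theta> * (E (F a) \<theta> * b \<theta>) \<partial>lborel) = (\<integral>\<theta>. m \<theta> * (E (F b) \<theta> * a \<theta>) \<partial>lborel)"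
    unfolding ip_E[OF bounded_borel_F[OF a] b] ip_E[OF bounded_borel_F[OF b] a] by (simp add: mult.commute[of "F a _"])
  also have "\<dots> = (\<integral>\<theta>. m \<theta> * (a \<theta> * E (F b) \<theta>) \<partial>lborel)"
    by (simp add: mult.commute[of "a _"])
  finally have "(\<integral>\<theta>. m \<theta> * (E (F a) \<theta> * b \<theta>) \<partial>lborel) = (\<integral>\<theta>. m \<theta> * (a \<theta> * E (F b) \<theta>) \<partial>lborel)" .
  then show "(\<integral>\<theta>. (\<integral>\<eta>. a \<eta> \<partial>gibbs_kernel (joint0 f g y) \<theta>) * b \<theta> \<partial>post_Theta (joint0 f g y)) =
    (\<integral>\<theta>. a \<theta> * (\<integral>\<eta>. b \<eta> \<partial>gibbs_kernel (joint0 f g y) \<theta>) \<partial>post_Theta (joint0 f g y))"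
    using a b by (simp add: integral_gibbs_kernel integral_post)
qed

lemma T_eq: "bounded_borel h \<Longrightarrow> T h = E (F h)"
  by (rule ext) (simp add: T_def integral_gibbs_kernel)

lemma T_cont: "bounded_borel h \<Longrightarrow> continuous_on UNIV (T h)"
  by (simp add: T_eq E_cont bounded_borel_F)

section \<open>Laws of the chain as powers of \<open>T\<close>, and geometric ergodicity as a
  pointwise rate\<close>

text \<open>Both claims go through one induction because the formula for integrals against a bind
  needs the previous law to be a Borel probability measure.\<close>

lemma gibbs_law_integral:
  "gibbs_law (joint0 f g y) n \<theta>0 \<in> space (prob_algebra borel) \<and>
   (\<forall>h. bounded_borel h \<longrightarrow> (\<integral>\<theta>. h \<theta> \<partial>gibbs_law (joint0 f g y) n \<theta>0) = (T ^^ n) h \<theta>0)"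
proof (induction n)
  case 0
  then show ?case
    by (auto simp: space_prob_algebra bounded_borel_def integral_return intro!: prob_space_return)
next
  case (Suc n)
  let ?L = "gibbs_law (joint0 f g y) n \<theta>0" and ?K = "gibbs_kernel (joint0 f g y)"
  have L: "prob_space ?L" "sets ?L = sets borel" using Suc by (auto simp: space_prob_algebra)
  have K: "?K \<in> ?L \<rightarrow>\<^sub>M subprob_algebra borel"
    using measurable_prob_algebraD[OF gibbs_kernel_kernel] L(2) by (simp cong: measurable_cong_sets)
  have "prob_space (?L \<bind> ?K)"
    by (rule prob_space.prob_space_bind[OF L(1) _ K]) (simp add: prob_K)
  moreover have "sets (?L \<bind> ?K) = sets borel"
    using L by (intro sets_bind) (auto simp: sets_K prob_space.not_empty)
  moreover have "(\<integral>\<theta>. h \<theta> \<partial>(?L \<bind> ?K)) = (T ^^ Suc n) h \<theta>0" if h: "bounded_borel h" for h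
  proof -
    obtain C where C: "\<And>x. \<bar>h x\<bar> \<le> C" using h by (auto simp: bounded_borel_def)
    have "(\<integral>\<theta>. h \<theta> \<partial>(?L \<bind> ?K)) = (\<integral>x. (\<integral>\<eta>. h \<eta> \<partial>?K x) \<partial>?L)"
      by (rule integral_bind[where K=borel and B=C and B'=1, OF _ _ K])
        (use h C L prob_K in \<open>auto simp: bounded_borel_def prob_space.finite_measure prob_space.emeasure_space_1\<close>)
    also have "\<dots> = (\<integral>x. T h x \<partial>?L)" by (simp add: T_def)
    also have "\<dots> = (T ^^ n) (T h) \<theta>0" using Suc h by (simp add: bounded_borel_T)
    finally show ?thesis by (simp add: funpow_swap1)
  qed
  ultimately show ?case by (simp add: space_prob_algebra)
qed

lemma measure_gibbs_law:
  assumes "A \<in> sets borel"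
  shows "measure (gibbs_law (joint0 f g y) n \<theta>0) A = (T ^^ n) (indicator A) \<theta>0"
proof -
  have "sets (gibbs_law (joint0 f g y) n \<theta>0) = sets borel"
    using gibbs_law_integral[of n \<theta>0] by (auto simp: space_prob_algebra)
  then have "measure (gibbs_law (joint0 f g y) n \<theta>0) A = (\<integral>\<theta>. indicator A \<theta> \<partial>gibbs_law (joint0 f g y) n \<theta>0)"
    using assms by (simp add: sets_eq_imp_space_eq)
  then show ?thesis using gibbs_law_integral[of n \<theta>0] assms by auto
qed

lemma geom_ergodic_rate:
  assumes "geom_ergodic (joint0 f g y)"
  obtains r where "0 \<le> r" "r < 1"
    "\<And>\<theta>. \<exists>C. \<forall>n\<ge>1. \<forall>A\<in>sets borel. \<bar>(T ^^ n) (indicator A) \<theta> - p A\<bar> \<le> C * r ^ n"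
proof -
  let ?j = "joint0 f g y"
  obtain r M where r: "r < 1" and M: "\<And>\<theta> n. tv_dist (gibbs_law ?j n \<theta>) (post_Theta ?j) \<le> M \<theta> * r ^ n"
    using assms unfolding geom_ergodic_def by blast
  have tv: "\<bar>(T ^^ n) (indicator A) \<theta> - p A\<bar> \<le> M \<theta> * r ^ n" if A: "A \<in> sets borel" for A n \<theta>
  proof -
    have P: "prob_space (gibbs_law ?j n \<theta>)"
      using gibbs_law_integral[of n \<theta>] by (auto simp: space_prob_algebra)
    have "\<bar>measure (gibbs_law ?j n \<theta>) B - p B\<bar> \<le> 1" for B
      using prob_space.prob_le_1[OF P, of B] prob_space.prob_le_1[OF prob_pi, of B]
        measure_nonneg[of "gibbs_law ?j n \<theta>" B] measure_nonneg[of "post_Theta ?j" B] by linarith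
    then have "\<bar>measure (gibbs_law ?j n \<theta>) A - p A\<bar> \<le> tv_dist (gibbs_law ?j n \<theta>) (post_Theta ?j)"
      unfolding tv_dist_def using A by (intro cSUP_upper) (auto intro!: bdd_aboveI2)
    with M[of n \<theta>] A show ?thesis by (simp add: measure_gibbs_law)
  qed
  \<comment> \<open>Geometric ergodicity allows a negative rate, whereas the gap argument needs a
    nonnegative one. If \<open>r < 0\<close>, the bounds at \<open>n = 0\<close> and
    \<open>n = 1\<close> force \<open>M \<theta> = 0\<close>, so that rate 0 serves as well.\<close>
  show ?thesis
  proof (rule that[of "max r 0"])
    fix \<theta>
    show "\<exists>C. \<forall>n\<ge>1. \<forall>A\<in>sets borel. \<bar>(T ^^ n) (indicator A) \<theta> - p A\<bar> \<le> C * max r 0 ^ n"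
    proof (cases "r \<ge> 0")
      case True
      then show ?thesis using tv by (auto simp: max_def)
    next
      case False
      have "0 \<le> M \<theta>" using tv[of "{}" 0 \<theta>] by simp
      moreover have "0 \<le> M \<theta> * r" using tv[of "{}" 1 \<theta>] by simp
      ultimately have "M \<theta> = 0" using False by (simp add: zero_le_mult_iff)
      then have "\<bar>(T ^^ n) (indicator A) \<theta> - p A\<bar> \<le> 0 * max r 0 ^ n" if "A \<in> sets borel" for n A
        using tv[OF that, of n \<theta>] by simp
      then show ?thesis by blast
    qed
  qed (use r in auto)
qed


section \<open>Consequences of RID: long tails and tight increments\<close>

lemma integral_cond_U1:
  assumes [measurable]: "h \<in> borel_measurable borel"
  shows "(\<integral>u. h u \<partial>cond_U (joint1 f g y) \<theta>) = (\<integral>u. h u * w (\<theta> + u) \<theta> \<partial>lborel) / m \<theta>"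
proof -
  have j: "joint1 f g y u \<theta> = w (\<theta> + u) \<theta>" for u
    by (simp add: joint1_def w_def algebra_simps)
  have "m \<theta> = (\<integral>u. w (\<theta> + u) \<theta> \<partial>lborel)"
    unfolding m_def using lborel_integral_real_affine[of 1 "\<lambda>x. w x \<theta>" \<theta>] by simp
  then have "cond_U (joint1 f g y) \<theta> = density lborel (\<lambda>u. ennreal (w (\<theta> + u) \<theta> / m \<theta>))"
    by (simp add: cond_U_def normdens_def j)
  then show ?thesis
    using w_pos m_pos by (simp add: integral_density less_imp_le mult.commute)
qed

text \<open>The limit is taken towards plus infinity, where the sticky interval will be
  placed.\<close>

lemma RID_tendsto:
  assumes "RID f g y" "continuous_on UNIV h" "bounded (range h)"
  shows "((\<lambda>\<theta>. (\<integral>u. h u * w (\<theta> + u) \<theta> \<partial>lborel) / m \<theta>) \<longlongrightarrow> (\<integral>u. h u * g u \<partial>lborel)) at_top"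
proof -
  have h: "h \<in> borel_measurable borel" using assms(2) by (rule borel_measurable_continuous_onI)
  have "((\<lambda>\<theta>. \<integral>x. h x \<partial>cond_U (joint1 f g y) \<theta>) \<longlongrightarrow> (\<integral>x. h x \<partial>density lborel (\<lambda>x. ennreal (g x)))) at_infinity"
    using assms unfolding RID_def weak_conv_along_def by blast
  moreover have "(\<integral>x. h x \<partial>density lborel (\<lambda>x. ennreal (g x))) = (\<integral>u. h u * g u \<partial>lborel)"
    using h g_pos by (simp add: integral_density less_imp_le mult.commute)
  ultimately show ?thesis
    using integral_cond_U1[OF h] tendsto_mono[OF at_top_le_at_infinity] by simp
qed

text \<open>A continuous stand-in for the indicator of [-S, S], since weak convergence tests
  continuous functions only.\<close>

definition bump :: "real \<Rightarrow> real \<Rightarrow> real" where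
  "bump S u = max 0 (min 1 (S - \<bar>u\<bar>))"

lemma bump_cont [continuous_intros]: "continuous_on A k \<Longrightarrow> continuous_on A (\<lambda>u. bump S (k u))"
  unfolding bump_def by (intro continuous_intros)

lemma bump_measurable [measurable]: "bump S \<in> borel_measurable borel"
  using bump_cont[OF continuous_on_id] by (intro borel_measurable_continuous_onI) simp

lemma bump_nonneg: "0 \<le> bump S u" and bump_le_1: "bump S u \<le> 1"
  by (auto simp: bump_def)

lemma bump_eq_0: "\<bar>u\<bar> \<ge> S \<Longrightarrow> bump S u = 0"
  by (auto simp: bump_def)

lemma bump_eq_1: "\<bar>u\<bar> \<le> S - 1 \<Longrightarrow> bump S u = 1"
  by (auto simp: bump_def)

lemma bump_int: "integrable lborel (bump S)"
proof (rule Bochner_Integration.integrable_bound)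
  show "integrable lborel (indicator {-S..S} :: real \<Rightarrow> real)"
    by (cases "-S \<le> S") (auto simp: integrable_indicator_iff)
  show "AE x in lborel. norm (bump S x) \<le> norm (indicator {-S..S} x :: real)"
    using bump_eq_0[of S] bump_nonneg bump_le_1 by (intro AE_I2) (auto simp: indicator_def)
qed simp

lemma locally_flat:
  assumes "RID f g y"
  shows "((\<lambda>\<theta>. (\<integral>u. bump 2 (u - s) * f (y - u - \<theta>) \<partial>lborel) / m \<theta>) \<longlongrightarrow> (\<integral>u. bump 2 u \<partial>lborel)) at_top"
proof -
  \<comment> \<open>Dividing the test function by \<open>g\<close> cancels the factor \<open>g\<close> of the conditional density, so RID
    becomes a statement about \<open>f\<close> alone.\<close>
  define h where "h u = bump 2 (u - s) / g u" for u
  have gn: "g u \<noteq> 0" for u using g_pos[of u] by simp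
  have hc: "continuous_on UNIV h" unfolding h_def
    using gn by (intro continuous_intros g_cont) auto
  \<comment> \<open>\<open>1 / g\<close> is unbounded on the line, but the bump confines the
    quotient to a compact interval, on which a continuous function is bounded.\<close>
  have "bounded (h ` {s - 2..s + 2})"
    using hc by (intro compact_imp_bounded compact_continuous_image) (auto intro: continuous_on_subset)
  moreover have "h u = 0" if "u \<notin> {s - 2..s + 2}" for u
    using that bump_eq_0[of 2 "u - s"] by (auto simp: h_def)
  then have "range h \<subseteq> insert 0 (h ` {s - 2..s + 2})" by blast
  ultimately have "bounded (range h)" by (meson bounded_insert bounded_subset)
  from RID_tendsto[OF assms hc this]
  have "((\<lambda>\<theta>. (\<integral>u. bump 2 (u - s) * f (y - u - \<theta>) \<partial>lborel) / m \<theta>) \<longlongrightarrow> (\<integral>u. bump 2 (u - s) \<partial>lborel)) at_top"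
    by (simp add: h_def w_def gn algebra_simps)
  moreover have "(\<integral>u. bump 2 (u - s) \<partial>lborel) = (\<integral>u. bump 2 u \<partial>lborel)"
    using lborel_integral_real_affine[of 1 "bump 2" "-s"] by simp
  ultimately show ?thesis by simp
qed

text \<open>The same number \<open>A (\<theta> + s)\<close> is compared with two denominators: with
  \<open>m \<theta>\<close> through the bump shifted by \<open>s\<close>, and with
  \<open>m (\<theta> + s)\<close> through the unshifted bump. Both ratios have the same positive
  limit, so the denominators are asymptotically equal.\<close>

lemma m_long_tailed:
  assumes "RID f g y"
  shows "((\<lambda>\<theta>. m (\<theta> + s) / m \<theta>) \<longlongrightarrow> 1) at_top"
proof -
  define \<kappa> where "\<kappa> = (\<integral>u. bump 2 u \<partial>lborel)"
  define A where "A \<theta> = (\<integral>u. bump 2 u * f (y - u - \<theta>) \<partial>lborel)" for \<theta>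
  have "(\<integral>u. indicator {-1..1} u \<partial>(lborel :: real measure)) \<le> \<kappa>"
    unfolding \<kappa>_def
  proof (rule integral_mono[OF _ bump_int])
    show "integrable (lborel :: real measure) (indicator {-1..1} :: real \<Rightarrow> real)"
      by (simp add: integrable_indicator_iff)
    show "indicator {-1..1} u \<le> bump 2 u" for u
      using bump_eq_1[of u 2] bump_nonneg[of 2 u] by (auto simp: indicator_def)
  qed
  then have \<kappa>: "\<kappa> > 0" by simp
  have "(\<integral>u. bump 2 (u - s) * f (y - u - \<theta>) \<partial>lborel) = A (\<theta> + s)" for \<theta>
    unfolding A_def
    using lborel_integral_real_affine[of 1 "\<lambda>u. bump 2 (u - s) * f (y - u - \<theta>)" s]
    by (simp add: algebra_simps)
  with locally_flat[OF assms, of s] have 1: "((\<lambda>\<theta>. A (\<theta> + s) / m \<theta>) \<longlongrightarrow> \<kappa>) at_top"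
    by (simp add: \<kappa>_def)
  have "((\<lambda>\<theta>. A \<theta> / m \<theta>) \<longlongrightarrow> \<kappa>) at_top"
    using locally_flat[OF assms, of 0] by (simp add: \<kappa>_def A_def)
  moreover have "filterlim (\<lambda>\<theta>. \<theta> + s) at_top at_top"
    using filterlim_tendsto_add_at_top[OF tendsto_const[of s] filterlim_ident] by (simp add: add.commute)
  ultimately have 2: "((\<lambda>\<theta>. A (\<theta> + s) / m (\<theta> + s)) \<longlongrightarrow> \<kappa>) at_top"
    by (rule filterlim_compose)
  have "((\<lambda>\<theta>. (A (\<theta> + s) / m \<theta>) / (A (\<theta> + s) / m (\<theta> + s))) \<longlongrightarrow> \<kappa> / \<kappa>) at_top"
    using \<kappa> by (intro tendsto_divide 1 2) auto
  moreover have "\<forall>\<^sub>F \<theta> in at_top. A (\<theta> + s) / m (\<theta> + s) > 0"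
    using 2 \<kappa> by (rule order_tendstoD)
  then have "\<forall>\<^sub>F \<theta> in at_top. (A (\<theta> + s) / m \<theta>) / (A (\<theta> + s) / m (\<theta> + s)) = m (\<theta> + s) / m \<theta>"
    by eventually_elim auto
  ultimately show ?thesis
    using \<kappa> by (simp add: tendsto_cong)
qed

lemma E_mono: "bounded_borel a \<Longrightarrow> bounded_borel b \<Longrightarrow> (\<And>x. a x \<le> b x) \<Longrightarrow> E a \<theta> \<le> E b \<theta>"
  unfolding E_def using w_pos m_pos[of \<theta>]
  by (intro divide_right_mono integral_mono continuous_weighted_integral(2) mult_right_mono)
    (auto simp: less_imp_le)

text \<open>One sweep makes two moves. The move from \<theta> to x is shorter than \<open>S\<close>
  with probability above \<open>1 - \<epsilon>\<close> for large \<theta>, by RID; the move from x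
  to the new \<theta> has density \<open>g\<close> up to sign for every x. Hence the square, and the
  radius \<open>2 * S\<close>.\<close>

lemma tight_increments:
  assumes "RID f g y" "0 < \<epsilon>" "\<epsilon> < 1"
  obtains s R where "s > 0"
    "\<And>\<theta> I. \<theta> \<ge> R \<Longrightarrow> I \<in> sets borel \<Longrightarrow> {\<theta> - s<..<\<theta> + s} \<subseteq> I \<Longrightarrow> T (indicator I) \<theta> \<ge> (1 - \<epsilon>)\<^sup>2"
proof -
  have "(\<lambda>n. \<integral>u. bump (real n) u * g u \<partial>lborel) \<longlonglongrightarrow> (\<integral>u. g u \<partial>lborel)"
  proof (rule integral_dominated_convergence[OF _ _ g_int])
    show "AE u in lborel. (\<lambda>n. bump (real n) u * g u) \<longlonglongrightarrow> g u"
    proof (intro AE_I2)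
      fix u :: real
      obtain N :: nat where N: "\<bar>u\<bar> + 1 \<le> real N" using real_arch_simple by blast
      have "\<forall>\<^sub>F n in sequentially. bump (real n) u * g u = g u"
        using eventually_ge_at_top[of N] by eventually_elim (use N in \<open>simp add: bump_eq_1\<close>)
      then show "(\<lambda>n. bump (real n) u * g u) \<longlonglongrightarrow> g u" by (rule tendsto_eventually)
    qed
    show "AE u in lborel. norm (bump (real n) u * g u) \<le> g u" for n
      using bump_nonneg bump_le_1 g_pos by (intro AE_I2) (simp add: abs_mult less_imp_le mult_left_le_one_le)
  qed auto
  then have "\<forall>\<^sub>F n in sequentially. (\<integral>u. bump (real n) u * g u \<partial>lborel) > 1 - \<epsilon>"
    using assms(2) by (intro order_tendstoD) (auto simp: g_one)
  then obtain n where n: "(\<integral>u. bump (real n) u * g u \<partial>lborel) > 1 - \<epsilon>"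
    using eventually_happens sequentially_bot by blast
  define S where "S = real n"
  have S: "S > 0"
  proof (rule ccontr)
    assume "\<not> S > 0"
    then have "bump S u = 0" for u by (intro bump_eq_0) (simp add: S_def)
    with n assms show False by (simp add: S_def)
  qed
  have "bounded (range (bump S))"
    using bump_nonneg bump_le_1 by (intro boundedI[of _ 1]) auto
  moreover have "continuous_on UNIV (bump S)" using bump_cont[OF continuous_on_id] by simp
  ultimately have "((\<lambda>\<theta>. (\<integral>u. bump S u * w (\<theta> + u) \<theta> \<partial>lborel) / m \<theta>) \<longlongrightarrow> (\<integral>u. bump S u * g u \<partial>lborel)) at_top"
    by (intro RID_tendsto assms(1))
  then have "\<forall>\<^sub>F \<theta> in at_top. (\<integral>u. bump S u * w (\<theta> + u) \<theta> \<partial>lborel) / m \<theta> > 1 - \<epsilon>"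
    using n by (intro order_tendstoD) (auto simp: S_def)
  then obtain R where R: "\<And>\<theta>. \<theta> \<ge> R \<Longrightarrow> (\<integral>u. bump S u * w (\<theta> + u) \<theta> \<partial>lborel) / m \<theta> > 1 - \<epsilon>"
    by (auto simp: eventually_at_top_linorder)
  show ?thesis
  proof (rule that[of "2 * S" R])
    fix \<theta> I assume \<theta>: "\<theta> \<ge> R" and I[measurable]: "I \<in> sets borel" and sub: "{\<theta> - 2 * S<..<\<theta> + 2 * S} \<subseteq> I"
    have bb: "bounded_borel (\<lambda>x. bump S (x - \<theta>))"
      using bump_nonneg bump_le_1 by (intro bounded_borelI[of _ 1]) auto
    have F: "F (indicator I) x \<ge> 1 - \<epsilon>" if "\<bar>x - \<theta>\<bar> < S" for x
    proof -
      have "1 - \<epsilon> \<le> (\<integral>u. bump S u * g u \<partial>lborel)" using n by (simp add: S_def)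
      also have "\<dots> = (\<integral>\<eta>. bump S (x - \<eta>) * g (x - \<eta>) \<partial>lborel)"
        using lborel_integral_real_affine[of "-1" "\<lambda>u. bump S u * g u" x] by simp
      also have "\<dots> \<le> F (indicator I) x"
        unfolding F_def
      proof (rule integral_mono)
        show "integrable lborel (\<lambda>\<eta>. bump S (x - \<eta>) * g (x - \<eta>))"
          using bump_nonneg bump_le_1 by (intro integrable_F bounded_borelI[of _ 1]) auto
        show "integrable lborel (\<lambda>\<eta>. indicator I \<eta> * g (x - \<eta>))" by (intro integrable_F) auto
        show "bump S (x - \<eta>) * g (x - \<eta>) \<le> indicator I \<eta> * g (x - \<eta>)" for \<eta>
        proof (cases "\<bar>x - \<eta>\<bar> < S")
          case True
          then have "\<eta> \<in> I" using sub that by (intro subsetD[OF sub]) auto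
          then show ?thesis using bump_le_1[of S "x - \<eta>"] g_pos[of "x - \<eta>"] by simp
        next
          case False
          then show ?thesis using g_pos[of "x - \<eta>"] by (simp add: bump_eq_0 indicator_def)
        qed
      qed
      finally show ?thesis .
    qed
    have Fnn: "0 \<le> F (indicator I) x" for x
      unfolding F_def using g_pos by (intro Bochner_Integration.integral_nonneg) (simp add: less_imp_le)
    have "(\<integral>u. bump S u * w (\<theta> + u) \<theta> \<partial>lborel) = (\<integral>x. bump S (x - \<theta>) * w x \<theta> \<partial>lborel)"
      using lborel_integral_real_affine[of 1 "\<lambda>x. bump S (x - \<theta>) * w x \<theta>" \<theta>] by simp
    with R[OF \<theta>] have "1 - \<epsilon> \<le> E (\<lambda>x. bump S (x - \<theta>)) \<theta>" by (simp add: E_def)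
    then have "(1 - \<epsilon>)\<^sup>2 \<le> (1 - \<epsilon>) * E (\<lambda>x. bump S (x - \<theta>)) \<theta>"
      using assms by (simp add: power2_eq_square)
    also have "\<dots> = E (\<lambda>x. (1 - \<epsilon>) * bump S (x - \<theta>)) \<theta>"
      by (simp add: E_def mult.assoc)
    also have "\<dots> \<le> E (F (indicator I)) \<theta>"
    proof (rule E_mono)
      show "bounded_borel (\<lambda>x. (1 - \<epsilon>) * bump S (x - \<theta>))" using bb by (intro bounded_borel_mult) auto
      show "(1 - \<epsilon>) * bump S (x - \<theta>) \<le> F (indicator I) x" for x
      proof (cases "\<bar>x - \<theta>\<bar> < S")
        case True
        have "(1 - \<epsilon>) * bump S (x - \<theta>) \<le> (1 - \<epsilon>) * 1"
          using assms bump_le_1 by (intro mult_left_mono) auto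
        with F[OF True] show ?thesis by simp
      qed (use Fnn in \<open>simp add: bump_eq_0\<close>)
    qed auto
    finally show "T (indicator I) \<theta> \<ge> (1 - \<epsilon>)\<^sup>2" by (simp add: T_eq)
  qed (use S in simp)
qed

section \<open>Posterior masses of far intervals, and the contradiction\<close>

lemma p_eq: "A \<in> sets borel \<Longrightarrow> p A = (\<integral>\<theta>. m \<theta> * indicator A \<theta> \<partial>lborel)"
  using integral_post[of "indicator A"] sets_pi by simp

lemma p_integrable: assumes "A \<in> sets borel" shows "integrable lborel (\<lambda>\<theta>. m \<theta> * indicator A \<theta>)"
  using m_int by (rule Bochner_Integration.integrable_bound)
    (use assms m_pos in \<open>auto simp: indicator_def less_imp_le\<close>)

lemma p_pos: assumes A: "A \<in> sets borel" and "emeasure lborel A \<noteq> 0" shows "p A > 0"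
proof -
  have "p A \<noteq> 0"
  proof
    assume "p A = 0"
    then have "AE \<theta> in lborel. m \<theta> * indicator A \<theta> = 0"
      unfolding p_eq[OF A] using m_pos p_integrable[OF A]
      by (subst (asm) integral_nonneg_eq_0_iff_AE) (auto simp: less_imp_le)
    then have "AE \<theta> in lborel. \<theta> \<notin> A"
      by (rule eventually_mono) (use m_pos in \<open>auto simp: less_imp_neq[symmetric]\<close>)
    then have "A \<in> null_sets lborel" using A by (subst AE_iff_null_sets) auto
    with assms(2) show False by (auto simp: null_sets_def)
  qed
  then show ?thesis by (simp add: zero_less_measure_iff)
qed

lemma tail_small:
  assumes "\<epsilon> > 0"
  obtains R where "\<And>A. A \<subseteq> {R..} \<Longrightarrow> p A \<le> \<epsilon>"
proof -
  interpret prob_space "post_Theta (joint0 f g y)" by (rule prob_pi)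
  have "(\<lambda>n. prob {real n..}) \<longlonglongrightarrow> prob (\<Inter>n. {real n..})"
  proof (rule finite_Lim_measure_decseq[where A="\<lambda>n. {real n..}"])
    show "range (\<lambda>n. {real n..}) \<subseteq> sets (post_Theta (joint0 f g y))" by (simp add: sets_pi image_subset_iff)
    show "decseq (\<lambda>n. {real n..})" by (simp add: decseq_def)
  qed
  moreover have "(\<Inter>n. {real n..}) = {}"
  proof -
    have "\<exists>n. x \<notin> {real n..}" for x
      using reals_Archimedean2[of x] by (auto simp: not_le)
    then show ?thesis by blast
  qed
  ultimately have "(\<lambda>n. prob {real n..}) \<longlonglongrightarrow> 0" by simp
  then have "\<forall>\<^sub>F n in sequentially. prob {real n..} < \<epsilon>"
    using assms by (rule order_tendstoD)
  then obtain n where n: "prob {real n..} < \<epsilon>"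
    using eventually_happens sequentially_bot by blast
  have "prob A \<le> \<epsilon>" if "A \<subseteq> {real n..}" for A
  proof -
    have "prob A \<le> prob {real n..}" using that sets_pi by (intro finite_measure_mono) auto
    with n show ?thesis by simp
  qed
  then show ?thesis by (rule that)
qed

lemma p_shift_le:
  assumes "\<And>\<theta>. \<theta> \<in> {a..<b} \<Longrightarrow> m (\<theta> + s) \<le> K * m \<theta>"
  shows "p {a + s..<b + s} \<le> K * p {a..<b}"
proof -
  have "p {a + s..<b + s} = (\<integral>\<theta>. m (s + 1 * \<theta>) * indicator {a + s..<b + s} (s + 1 * \<theta>) \<partial>lborel)"
    using lborel_integral_real_affine[of 1 "\<lambda>\<theta>. m \<theta> * indicator {a + s..<b + s} \<theta>" s] by (simp add: p_eq)
  also have "\<dots> \<le> (\<integral>\<theta>. K * (m \<theta> * indicator {a..<b} \<theta>) \<partial>lborel)"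
  proof (rule integral_mono)
    show "integrable lborel (\<lambda>\<theta>. m (s + 1 * \<theta>) * indicator {a + s..<b + s} (s + 1 * \<theta>))"
      by (rule lborel_integrable_real_affine[OF p_integrable]) auto
    show "integrable lborel (\<lambda>\<theta>. K * (m \<theta> * indicator {a..<b} \<theta>))"
      using p_integrable[of "{a..<b}"] by simp
  qed (use assms in \<open>auto simp: indicator_def add.commute\<close>)
  finally show ?thesis by (simp add: p_eq)
qed

lemma p_shift_ge:
  assumes "\<And>\<theta>. \<theta> \<in> {a..<b} \<Longrightarrow> m \<theta> \<le> K * m (\<theta> + s)"
  shows "p {a..<b} \<le> K * p {a + s..<b + s}"
proof -
  have "p {(a + s) + - s..<(b + s) + - s} \<le> K * p {a + s..<b + s}"
  proof (rule p_shift_le)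
    fix \<theta> assume "\<theta> \<in> {a + s..<b + s}"
    then show "m (\<theta> + - s) \<le> K * m \<theta>" using assms[of "\<theta> - s"] by simp
  qed
  then show ?thesis by simp
qed

lemma p_split: assumes "a \<le> b" "b \<le> c" shows "p {a..<c} = p {a..<b} + p {b..<c}"
proof -
  interpret prob_space "post_Theta (joint0 f g y)" by (rule prob_pi)
  have "{a..<c} = {a..<b} \<union> {b..<c}" using assms by auto
  moreover have "prob ({a..<b} \<union> {b..<c}) = prob {a..<b} + prob {b..<c}"
    using sets_pi by (intro finite_measure_Union) auto
  ultimately show ?thesis by simp
qed

text \<open>Two of the three factors \<open>1 - \<epsilon>\<close> bound the probability of staying
  in \<open>I\<close> when starting in the inner part \<open>J\<close>; the third is the share of
  the mass of \<open>I\<close> carried by \<open>J\<close>.\<close>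

lemma sticky_interval:
  assumes rid: "RID f g y" and \<epsilon>: "0 < \<epsilon>" "\<epsilon> < 1"
  obtains I where "I \<in> sets borel" "0 < p I" "p I \<le> \<epsilon>"
    "(1 - \<epsilon>) ^ 3 * p I \<le> ip (T (indicator I)) (indicator I)"
proof -
  obtain s R1 where s: "s > 0" and R1: "\<And>\<theta> I. \<theta> \<ge> R1 \<Longrightarrow> I \<in> sets borel \<Longrightarrow>
      {\<theta> - s<..<\<theta> + s} \<subseteq> I \<Longrightarrow> T (indicator I) \<theta> \<ge> (1 - \<epsilon>)\<^sup>2"
    using tight_increments[OF rid \<epsilon>] by blast
  obtain R3 where R3: "\<And>A. A \<subseteq> {R3..} \<Longrightarrow> p A \<le> \<epsilon>" using tail_small[OF \<epsilon>(1)] by blast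
  \<comment> \<open>There will be \<open>n\<close> inner blocks and two end blocks. Each end block
    carries at most a share \<open>2 / N\<close>, so both together carry at most
    \<open>4 / N \<le> \<epsilon>\<close>. The count comes before the position because
    \<open>K\<close> depends on \<open>N\<close>, and the threshold \<open>R2\<close> on
    \<open>K\<close>.\<close>
  obtain n :: nat where n: "4 / \<epsilon> \<le> real n" using real_arch_simple by blast
  define N where "N = n + 2"
  have N: "4 / real N \<le> \<epsilon>"
    using n \<epsilon> by (simp add: N_def field_simps add_pos_nonneg)
  \<comment> \<open>The ratio allowed between neighbouring blocks, chosen so that it compounds to at
    most 2 across the whole interval.\<close>
  define K where "K = root N 2"
  have K1: "K > 1" by (simp add: K_def N_def)
  have KN: "K ^ N = 2" unfolding K_def by (rule real_root_pow_pos) (auto simp: N_def)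
  have "\<forall>\<^sub>F \<theta> in at_top. m (\<theta> + s) / m \<theta> < K" "\<forall>\<^sub>F \<theta> in at_top. m (\<theta> + s) / m \<theta> > 1 / K"
    using K1 by (auto intro!: order_tendstoD[OF m_long_tailed[OF rid]])
  then have "\<forall>\<^sub>F \<theta> in at_top. m (\<theta> + s) \<le> K * m \<theta> \<and> m \<theta> \<le> K * m (\<theta> + s)"
  proof eventually_elim
    case (elim \<theta>)
    then show ?case using m_pos[of \<theta>] K1 by (simp add: field_simps)
  qed
  then obtain R2 where R2: "\<And>\<theta>. \<theta> \<ge> R2 \<Longrightarrow> m (\<theta> + s) \<le> K * m \<theta> \<and> m \<theta> \<le> K * m (\<theta> + s)"
    by (auto simp: eventually_at_top_linorder)
  define c where "c = max R1 (max R2 R3)"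
  define e where "e i = c + real i * s" for i
  define W where "W i = p {e i..<e (Suc i)}" for i
  have eS: "e (Suc i) = e i + s" for i by (simp add: e_def algebra_simps)
  have e_mono: "e i \<le> e k" if "i \<le> k" for i k
    using that s by (simp add: e_def mult_right_mono)
  have ce: "c \<le> e i" for i using s by (simp add: e_def)
  have Wnn: "0 \<le> W i" for i by (simp add: W_def)
  have "p {e i + s..<e (Suc i) + s} \<le> K * p {e i..<e (Suc i)}" for i
    using R2 ce[of i] by (intro p_shift_le) (auto simp: c_def)
  moreover have "p {e i..<e (Suc i)} \<le> K * p {e i + s..<e (Suc i) + s}" for i
    using R2 ce[of i] by (intro p_shift_ge) (auto simp: c_def)
  ultimately have "W (Suc i) \<le> K * W i" "W i \<le> K * W (Suc i)" for i
    by (simp_all only: W_def eS)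
  note step = this
  have far: "W (i + k) \<le> K ^ k * W i \<and> W i \<le> K ^ k * W (i + k)" for i k
  proof (induction k)
    case (Suc k)
    have "W (i + Suc k) \<le> K * W (i + k)" using step(1)[of "i + k"] by simp
    also have "\<dots> \<le> K * (K ^ k * W i)" using Suc K1 by simp
    finally have 1: "W (i + Suc k) \<le> K ^ Suc k * W i" by simp
    have "W i \<le> K ^ k * W (i + k)" using Suc by simp
    also have "\<dots> \<le> K ^ k * (K * W (i + Suc k))" using step(2)[of "i + k"] K1 by simp
    finally show ?case using 1 by (simp add: mult_ac)
  qed simp
  have K2: "K ^ k * W i \<le> 2 * W i" if "k \<le> N" for i k
    using power_increasing[OF that, of K] K1 KN Wnn by (intro mult_right_mono) auto
  define I where "I = {e 0..<e N}"
  define J where "J = {e 1..<e (Suc n)}"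
  have "p {e 0..<e k} = (\<Sum>i<k. W i)" for k
  proof (induction k)
    case (Suc k)
    then show ?case
      using p_split[OF e_mono[of 0 k] e_mono[of k "Suc k"]] by (simp add: W_def)
  qed simp
  then have pI: "p I = (\<Sum>i<N. W i)" by (simp add: I_def)
  \<comment> \<open>An end block weighs at most twice each of the \<open>N\<close> blocks; summing
    over all of them bounds its share.\<close>
  have ends: "W k * (real N) \<le> 2 * p I" if k: "k = 0 \<or> k = Suc n" for k
  proof -
    have "W k \<le> 2 * W i" if "i < N" for i
    proof (cases "k = 0")
      case True
      have "W 0 \<le> K ^ i * W i" using far[of 0 i] by simp
      with K2[of i i] that True show ?thesis by simp
    next
      case False
      then have "k = i + (k - i)" using k that by (auto simp: N_def)
      then have "W k \<le> K ^ (k - i) * W i" using far[of i "k - i"] by simp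
      moreover have "k - i \<le> N" using k by (auto simp: N_def)
      ultimately show ?thesis using K2[of "k - i" i] by simp
    qed
    then have "(\<Sum>i<N. W k) \<le> (\<Sum>i<N. 2 * W i)" by (intro sum_mono) auto
    then show ?thesis by (simp add: pI sum_distrib_left mult.commute)
  qed
  have "p I = W 0 + p J + W (Suc n)"
    using p_split[OF e_mono[of 0 1] e_mono[of 1 N]] p_split[OF e_mono[of 1 "Suc n"] e_mono[of "Suc n" N]]
    by (simp add: I_def J_def W_def N_def)
  moreover have "W 0 + W (Suc n) \<le> \<epsilon> * p I"
  proof -
    have "N > 0" by (simp add: N_def)
    then have "W 0 + W (Suc n) \<le> (4 / real N) * p I"
      using ends[of 0] ends[of "Suc n"] by (simp add: field_simps)
    also have "\<dots> \<le> \<epsilon> * p I" using N by (intro mult_right_mono) auto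
    finally show ?thesis .
  qed
  ultimately have pJ: "(1 - \<epsilon>) * p I \<le> p J" by (simp add: algebra_simps)
  have Tnn: "0 \<le> T (indicator I) \<theta>" for \<theta>
    unfolding T_def by (intro Bochner_Integration.integral_nonneg) auto
  have "(1 - \<epsilon>)\<^sup>2 * p J = ip (\<lambda>x. (1 - \<epsilon>)\<^sup>2) (indicator J)"
    using sets_pi by (simp add: ip_def J_def)
  also have "\<dots> \<le> ip (T (indicator I)) (indicator I)"
  proof (rule ip_mono)
    fix x
    show "(1 - \<epsilon>)\<^sup>2 * indicator J x \<le> T (indicator I) x * indicator I x"
    proof (cases "x \<in> J")
      case True
      \<comment> \<open>A point of \<open>J\<close> has a full block of length \<open>s\<close> on
        either side within \<open>I\<close>, exactly the radius of the window.\<close>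
      have "{x - s<..<x + s} \<subseteq> I"
        using True eS[of 0] eS[of "Suc n"] by (auto simp: I_def J_def N_def)
      moreover have "x \<ge> R1" using True ce[of 1] by (simp add: J_def c_def)
      ultimately have "(1 - \<epsilon>)\<^sup>2 \<le> T (indicator I) x" by (intro R1) (auto simp: I_def)
      moreover have "x \<in> I"
        using True e_mono[of 0 1] e_mono[of "Suc n" N] by (auto simp: I_def J_def N_def)
      ultimately show ?thesis using True by simp
    qed (use Tnn in \<open>simp add: indicator_def\<close>)
  qed (auto simp: I_def J_def)
  finally have "(1 - \<epsilon>)\<^sup>2 * p J \<le> ip (T (indicator I)) (indicator I)" .
  moreover have "(1 - \<epsilon>)\<^sup>2 * ((1 - \<epsilon>) * p I) \<le> (1 - \<epsilon>)\<^sup>2 * p J"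
    using pJ by (intro mult_left_mono) auto
  ultimately have "(1 - \<epsilon>) ^ 3 * p I \<le> ip (T (indicator I)) (indicator I)"
    by (simp add: power3_eq_cube power2_eq_square mult_ac)
  moreover have "p I \<le> \<epsilon>" using ce[of 0] by (intro R3) (auto simp: I_def c_def)
  moreover have "0 < p I"
    using s by (intro p_pos) (auto simp: I_def e_def N_def)
  ultimately show ?thesis by (intro that[of I]) (auto simp: I_def)
qed

lemma RID_imp_not_geom_ergodic:
  assumes "RID f g y"
  shows "\<not> geom_ergodic (joint0 f g y)"
proof
  assume "geom_ergodic (joint0 f g y)"
  then obtain r where r: "0 \<le> r" "r < 1"
    and rate: "\<And>\<theta>. \<exists>C. \<forall>n\<ge>1. \<forall>A\<in>sets borel. \<bar>(T ^^ n) (indicator A) \<theta> - p A\<bar> \<le> C * r ^ n"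
    using geom_ergodic_rate by blast
  \<comment> \<open>By Bernoulli's inequality and \<open>p I \<le> \<epsilon>\<close>, the gap
    inequality will give \<open>1 - 3 * \<epsilon> \<le> r + \<epsilon>\<close>, that is
    \<open>1 - r \<le> 4 * \<epsilon>\<close>; this choice makes \<open>4 * \<epsilon>\<close> half
    of \<open>1 - r\<close>.\<close>
  define \<epsilon> where "\<epsilon> = (1 - r) / 8"
  have \<epsilon>: "0 < \<epsilon>" "\<epsilon> < 1" using r by (auto simp: \<epsilon>_def)
  obtain I where I: "I \<in> sets borel" "0 < p I" "p I \<le> \<epsilon>"
    "(1 - \<epsilon>) ^ 3 * p I \<le> ip (T (indicator I)) (indicator I)"
    using sticky_interval[OF assms \<epsilon>] by blast
  have "1 + real 3 * (- \<epsilon>) \<le> (1 + (- \<epsilon>)) ^ 3" using \<epsilon> by (intro Bernoulli_inequality) auto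
  then have "(1 - 3 * \<epsilon>) * p I \<le> (1 - \<epsilon>) ^ 3 * p I" using I(2) by (intro mult_right_mono) auto
  also have "\<dots> \<le> r * (p I - (p I)\<^sup>2) + (p I)\<^sup>2"
    using I(4) pointwise_rate_imp_gap[OF I(1) r(1) T_cont rate] by simp
  also have "\<dots> \<le> (r + p I) * p I"
    using r by (simp add: power2_eq_square algebra_simps)
  finally have "1 - 3 * \<epsilon> \<le> r + p I" using I(2) by simp
  with I(3) r show False by (simp add: \<epsilon>_def field_simps)
qed

end

text \<open>The substitution \<open>x = y - u\<close> turns the non-centred chain of \<open>(f1, f2)\<close> into the centred
  chain of \<open>(f2, f1)\<close>, and RIP into RID.\<close>

lemma joint1_eq_joint0: "joint1 f1 f2 y u = joint0 f2 f1 y (y - u)"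
  by (rule ext) (simp add: joint1_def joint0_def mult.commute)

lemma normdens_reflect:
  fixes y :: real
  assumes [measurable]: "\<phi> \<in> borel_measurable borel"
  shows "distr (normdens (\<lambda>u. \<phi> (y - u))) borel (\<lambda>u. y - u) = normdens \<phi>"
proof -
  have d: "distr lborel borel (\<lambda>u. y - u) = (lborel :: real measure)"
    using lborel_real_affine[of "-1" y] by (simp add: density_1)
  have i: "(\<integral>u. \<phi> (y - u) \<partial>lborel) = (\<integral>u. \<phi> u \<partial>lborel)"
    using lborel_integral_real_affine[of "-1" \<phi> y] by simp
  show ?thesis
    using density_distr[of "\<lambda>t. ennreal (\<phi> t / (\<integral>u. \<phi> u \<partial>lborel))" borel "\<lambda>u. y - u" lborel]
    by (simp add: normdens_def i d)
qed

context flat_gibbs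
begin

lemma cond_U_joint1_reflect:
  "cond_U (joint0 f g y) \<theta> = distr (cond_U (joint1 g f y) \<theta>) borel (\<lambda>u. y - u)"
proof -
  have "(\<lambda>x. joint0 f g y x \<theta>) \<in> borel_measurable borel" unfolding joint0_def by measurable
  from normdens_reflect[OF this, of y] show ?thesis
    by (simp add: cond_U_def joint1_eq_joint0)
qed

text \<open>The latent variable is integrated out within one sweep, so a change of its coordinate is
  invisible to the \<Theta>-chain: the reflection of the first half-step is absorbed into the second
  by \<open>bind_distr\<close>.\<close>

lemma gibbs_kernel_joint1: "gibbs_kernel (joint1 g f y) = gibbs_kernel (joint0 f g y)"
proof
  fix \<theta>
  have "cond_Theta (joint1 g f y) = (\<lambda>u. cond_Theta (joint0 f g y) (y - u))"
    by (rule ext) (simp add: cond_Theta_def joint1_eq_joint0)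
  moreover have "distr (cond_U (joint1 g f y) \<theta>) borel (\<lambda>u. y - u) \<bind> cond_Theta (joint0 f g y) =
      cond_U (joint1 g f y) \<theta> \<bind> (\<lambda>u. cond_Theta (joint0 f g y) (y - u))"
    by (rule bind_distr[OF _ measurable_prob_algebraD[OF cond_Theta_kernel]])
      (auto simp: cond_U_def normdens_def)
  ultimately show "gibbs_kernel (joint1 g f y) \<theta> = gibbs_kernel (joint0 f g y) \<theta>"
    by (simp add: gibbs_kernel_def cond_U_joint1_reflect)
qed

lemma geom_ergodic_joint1: "geom_ergodic (joint1 g f y) \<longleftrightarrow> geom_ergodic (joint0 f g y)"
proof -
  have "gibbs_law (joint1 g f y) n \<theta> = gibbs_law (joint0 f g y) n \<theta>" for n \<theta>
    by (induction n) (simp_all add: gibbs_kernel_joint1)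
  moreover have "post_Theta (joint1 g f y) = post_Theta (joint0 f g y)"
    using lborel_integral_real_affine[of "-1" "\<lambda>u. joint0 f g y u _" y]
    by (simp add: post_Theta_def joint1_eq_joint0)
  ultimately show ?thesis by (simp add: geom_ergodic_def)
qed

text \<open>Reflecting the test function carries the limit law of Z_1 + y to that of -Z_1, and the
  symmetry of \<open>f\<close> identifies the latter with the law of Z_1.\<close>

lemma RIP_imp_RID_swap:
  assumes "RIP f g y"
  shows "RID g f y"
  unfolding RID_def weak_conv_along_def
proof (intro allI impI)
  fix h :: "real \<Rightarrow> real" assume h: "continuous_on UNIV h" "bounded (range h)"
  define k where "k x = h (y - x)" for x
  have hm[measurable]: "h \<in> borel_measurable borel" using h(1) by (rule borel_measurable_continuous_onI)
  have km[measurable]: "k \<in> borel_measurable borel" unfolding k_def by measurable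
  have "continuous_on UNIV k"
    unfolding k_def by (intro continuous_on_compose2[OF h(1)] continuous_intros) auto
  moreover have "bounded (range k)"
    using h(2) by (rule bounded_subset) (auto simp: k_def)
  ultimately have "((\<lambda>\<theta>. \<integral>x. k x \<partial>cond_U (joint0 f g y) \<theta>) \<longlongrightarrow>
      (\<integral>x. k x \<partial>density lborel (\<lambda>x. ennreal (f (x - y))))) at_infinity"
    using assms unfolding RIP_def weak_conv_along_def by blast
  moreover have "(\<integral>x. k x \<partial>cond_U (joint0 f g y) \<theta>) = (\<integral>u. h u \<partial>cond_U (joint1 g f y) \<theta>)" for \<theta>
    unfolding cond_U_joint1_reflect by (subst integral_distr) (auto simp: cond_U_def normdens_def k_def)
  moreover have "(\<integral>x. k x \<partial>density lborel (\<lambda>x. ennreal (f (x - y)))) = (\<integral>u. h u \<partial>density lborel (\<lambda>u. ennreal (f u)))"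
  proof -
    have "(\<integral>x. f (x - y) * h (y - x) \<partial>lborel) = (\<integral>u. f (- u) * h u \<partial>lborel)"
      using lborel_integral_real_affine[of "-1" "\<lambda>u. f (- u) * h u" y] by simp
    then show ?thesis
      using f_pos by (simp add: integral_density less_imp_le k_def f_sym)
  qed
  ultimately show "((\<lambda>\<theta>. \<integral>u. h u \<partial>cond_U (joint1 g f y) \<theta>) \<longlongrightarrow>
      (\<integral>u. h u \<partial>density lborel (\<lambda>x. ennreal (f x)))) at_infinity" by simp
qed

end

theorem mainTheorem2:
  fixes f1 f2 :: "real \<Rightarrow> real" and y :: real
  assumes "good_density f1" and "good_density f2"
    and "(\<integral>\<^sup>+\<theta>. (\<integral>\<^sup>+x. ennreal (joint0 f1 f2 y x \<theta>) \<partial>lborel) \<partial>lborel) < \<infinity>"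
  shows "(RID f1 f2 y \<longrightarrow> \<not> geom_ergodic (joint0 f1 f2 y))
       \<and> (RIP f1 f2 y \<longrightarrow> \<not> geom_ergodic (joint1 f1 f2 y))"
proof -
  \<comment> \<open>\<open>A\<close> settles the centred sampler and converts RIP for
    \<open>f1\<close>, \<open>f2\<close> into RID for \<open>f2\<close>, \<open>f1\<close>;
    \<open>B\<close> applies the same result to the exchanged densities, whose centred chain is the
    non-centred chain of \<open>f1\<close>, \<open>f2\<close>.\<close>
  interpret A: flat_gibbs f1 f2 y using assms by unfold_locales
  interpret B: flat_gibbs f2 f1 y using assms by unfold_locales
  show ?thesis
    using A.RID_imp_not_geom_ergodic B.RID_imp_not_geom_ergodic A.RIP_imp_RID_swap
      B.geom_ergodic_joint1 by blast
qed

end
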